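(* Let $d\in(0,1/2)$, let $\mu_1\neq\mu_2$ be known real numbers, let $\lambda_0\in[0,1/2-d]$, and let $F_0$ be the c.d.f. of a probability distribution on $\mathbb{R}$ symmetric about $0$. Let $X_1,X_2,\dots$ be i.i.d. real random variables with c.d.f. $G(x)=\lambda_0F_0(x-\mu_1)+(1-\lambda_0)F_0(x-\mu_2)$, and let $\hat\lambda_n$ be the estimator $$\hat\lambda_n=\underset{\lambda\in[0,1/2-d]}{\arg\min}\;K(\lambda;\hat G_n),\qquad K(\lambda;\hat G_n)=\int_{\mathbb{R}}\big(\hat G^{(n)}_\lambda(x)-\hat G_n(x)\big)^2\,d\hat G_n(x).$$ Assume that $F_0$ is strictly increasing and Lipschitz on $\mathbb{R}$. Then, as $n\to+\infty$: (i) $\hat\lambda_n$ converges almost surely to $\lambda_0$; (ii) $\sqrt n(\hat\lambda_n-\lambda_0)=O_P(1)$.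
   Context: $\hat G_n(x)=\frac1n\sum_{i=1}^n\mathbf{1}_{X_i\le x}$ is the empirical c.d.f. For $\lambda\in[0,1/2-d]$, $\hat G^{(n)}_\lambda=A_\lambda S_rA_\lambda^{-1}\hat G_n$, where, with $\tau_\mu f=f(\cdot-\mu)$ and $\eta=\mu_2-\mu_1$, $$A_\lambda=\lambda\tau_{\mu_1}+(1-\lambda)\tau_{\mu_2},\qquad A_\lambda^{-1}=\frac{1}{1-\lambda}\sum_{k\ge 0}\Big(\frac{-\lambda}{1-\lambda}\Big)^k\tau_{-\mu_2-k\eta},$$ acting on bounded functions on $\mathbb{R}$, and $(S_rF)(x)=1-F(-x)$. $O_P(1)$ means bounded in probability (tight). *)

theory Defs
  imports "HOL-Probability.Probability"
begin

definition translate :: "real \<Rightarrow> (real \<Rightarrow> real) \<Rightarrow> real \<Rightarrow> real" where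
  "translate \<mu> f = (\<lambda>x. f (x - \<mu>))"

definition mix_op :: "real \<Rightarrow> real \<Rightarrow> real \<Rightarrow> (real \<Rightarrow> real) \<Rightarrow> real \<Rightarrow> real" where
  "mix_op \<mu>1 \<mu>2 l f = (\<lambda>x. l * translate \<mu>1 f x + (1 - l) * translate \<mu>2 f x)"

text \<open>
  The Neumann series of the inverse of \<^const>\<open>mix_op\<close>, evaluated pointwise. For bounded
  \<open>f\<close> and \<open>0 \<le> l < 1/2\<close> it converges absolutely, uniformly in \<open>x\<close>; outside that range
  the value of the infinite sum may be meaningless.
\<close>

definition mix_inv :: "real \<Rightarrow> real \<Rightarrow> real \<Rightarrow> (real \<Rightarrow> real) \<Rightarrow> real \<Rightarrow> real" where
  "mix_inv \<mu>1 \<mu>2 l f =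
     (\<lambda>x. 1 / (1 - l) * (\<Sum>k. (- l / (1 - l)) ^ k * translate (- \<mu>2 - real k * (\<mu>2 - \<mu>1)) f x))"

definition refl_op :: "(real \<Rightarrow> real) \<Rightarrow> real \<Rightarrow> real" where
  "refl_op F = (\<lambda>x. 1 - F (- x))"

definition sym_mix :: "real \<Rightarrow> real \<Rightarrow> real \<Rightarrow> (real \<Rightarrow> real) \<Rightarrow> real \<Rightarrow> real" where
  "sym_mix \<mu>1 \<mu>2 l F = mix_op \<mu>1 \<mu>2 l (refl_op (mix_inv \<mu>1 \<mu>2 l F))"

text \<open>The sample is indexed from 1.\<close>

definition emp_cdf :: "(nat \<Rightarrow> 'a \<Rightarrow> real) \<Rightarrow> nat \<Rightarrow> 'a \<Rightarrow> real \<Rightarrow> real" where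
  "emp_cdf X n \<omega> = (\<lambda>x. (1 / real n) * (\<Sum>i=1..n. indicator {..x} (X i \<omega>)))"

text \<open>
  Integration against \<open>dF\<close> is integration with respect to the Lebesgue-Stieltjes measure of
  \<open>F\<close>, which is meaningful when \<open>F\<close> is nondecreasing and right-continuous.
\<close>

definition contrast :: "real \<Rightarrow> real \<Rightarrow> real \<Rightarrow> (real \<Rightarrow> real) \<Rightarrow> real" where
  "contrast \<mu>1 \<mu>2 l F = (LINT x | interval_measure F. (sym_mix \<mu>1 \<mu>2 l F x - F x)\<^sup>2)"

end

theory Submission
  imports Defs
begin

text \<open>
  Write \<open>D\<close> for the empirical c.d.f. minus the true c.d.f. \<open>G\<close>, and \<open>A\<close>, \<open>A*\<close> for the mixing operator
  with weight \<open>l\<close> and its adjoint. Since reflection intertwines \<open>A\<close> and \<open>A*\<close>, applying \<open>A*\<close> to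
  \<open>sym_mix l G - G\<close> yields \<open>(l - l0) (F0(x + \<eta>) - F0(x - \<eta>))\<close> with \<open>\<eta> = \<mu>2 - \<mu>1\<close>. The last factor never
  vanishes, and \<open>A*\<close> is invertible in the sup norm; so \<open>\<bar>sym_mix l G - G\<bar>\<close> is at least a constant times
  \<open>\<bar>l - l0\<bar>\<close> on a fixed neighbourhood of \<open>\<mu>1\<close> or of \<open>\<mu>2\<close>.

  Comparing the contrast at its minimiser with the contrast at \<open>l0\<close> gives the deterministic inequality
  \<open>(lhat - l0)\<^sup>2 \<le> C W\<close>, where \<open>W\<close> combines the values of \<open>D\<^sup>2\<close> at four fixed points with the sample mean
  of \<open>D(x)\<^sup>2 + (\<Sum>k. q ^ k * D(e k - x)\<^sup>2)\<close> for fixed shifts \<open>e k\<close>. The minimiser being random, this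
  domination by a quantity independent of \<open>l\<close> replaces empirical process theory: \<open>W \<longlonglongrightarrow> 0\<close> almost surely by
  Glivenko-Cantelli (Hoeffding and Borel-Cantelli), and the expectation of \<open>W\<close> is \<open>O(1/n)\<close> by a
  variance computation.
\<close>

section \<open>The mixing operator and its inverse\<close>

text \<open>The Neumann series and the \<open>q\<close>-weighted series below get their summability
  and bounds from this comparison.\<close>

lemma abs_suminf_le_geometric:
  fixes f :: "nat \<Rightarrow> real"
  assumes f: "\<And>k. \<bar>f k\<bar> \<le> p ^ k * B" and p: "0 \<le> p" "p < 1"
  shows "summable f" and "\<bar>suminf f\<bar> \<le> B / (1 - p)"
proof -
  have s: "summable (\<lambda>k. p ^ k * B)"
    using p by (intro summable_mult2 summable_geometric) auto
  have sa: "summable (\<lambda>k. \<bar>f k\<bar>)"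
    by (rule summable_comparison_test'[OF s, of 0]) (use f in auto)
  then show "summable f"
    by (rule summable_rabs_cancel)
  have "\<bar>suminf f\<bar> \<le> (\<Sum>k. \<bar>f k\<bar>)"
    by (rule summable_rabs[OF sa])
  also have "\<dots> \<le> (\<Sum>k. p ^ k * B)"
    by (rule suminf_le[OF f sa s])
  also have "\<dots> = B / (1 - p)"
    using p by (subst suminf_mult2[symmetric]) (auto simp: suminf_geometric)
  finally show "\<bar>suminf f\<bar> \<le> B / (1 - p)" .
qed

lemma mix_ratio:
  fixes l :: real
  assumes "0 \<le> l" "l < 1/2"
  shows "\<bar>- l / (1 - l)\<bar> = l / (1 - l)" "0 \<le> l / (1 - l)" "l / (1 - l) < 1"
  using assms by (auto simp: abs_if field_simps)

lemma mix_inv_summand_le: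
  fixes l :: real
  assumes l: "0 \<le> l" "l < 1/2" and F: "\<And>x. \<bar>F x\<bar> \<le> B"
  shows "\<bar>(- l / (1 - l)) ^ k * F x\<bar> \<le> (l / (1 - l)) ^ k * B"
  unfolding abs_mult power_abs mix_ratio(1)[OF l]
  using mix_ratio(2)[OF l] F by (intro mult_left_mono) auto

text \<open>The geometric sum \<open>1 / (1 - l / (1 - l))\<close> and the prefactor
  \<open>1 / (1 - l)\<close> multiply to \<open>1 / (1 - 2 * l)\<close>.\<close>

lemma abs_mix_inv_le:
  assumes l: "0 \<le> l" "l < 1/2" and F: "\<And>x. \<bar>F x\<bar> \<le> B"
  shows "\<bar>mix_inv \<mu>1 \<mu>2 l F x\<bar> \<le> B / (1 - 2 * l)"
proof -
  have "\<bar>mix_inv \<mu>1 \<mu>2 l F x\<bar> \<le> 1 / (1 - l) * (B / (1 - l / (1 - l)))"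
    unfolding mix_inv_def abs_mult
    using abs_suminf_le_geometric(2)[OF mix_inv_summand_le[OF l F] mix_ratio(2,3)[OF l]] l
    by (intro mult_mono) (auto simp: translate_def)
  also have "\<dots> = B / (1 - 2 * l)"
    using l by (simp add: divide_simps)
  finally show ?thesis .
qed

text \<open>The series telescopes: passing from \<open>\<mu>2\<close> to \<open>\<mu>1\<close>
  shifts the argument by one step \<open>\<mu>2 - \<mu>1\<close>, and the weight \<open>l\<close>
  supplies one more factor of the ratio, with opposite sign. Everything cancels except the head
  \<open>F y\<close>.\<close>

lemma mix_op_mix_inv:
  assumes l: "0 \<le> l" "l < 1/2" and F: "\<And>x. \<bar>F x\<bar> \<le> B"
  shows "mix_op \<mu>1 \<mu>2 l (mix_inv \<mu>1 \<mu>2 l F) = F"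
proof
  fix y
  let ?\<rho> = "- l / (1 - l)"
  let ?a = "\<lambda>k. ?\<rho> ^ k * F (y + real k * (\<mu>2 - \<mu>1))"
  have s: "summable ?a"
    by (rule abs_suminf_le_geometric(1)[OF mix_inv_summand_le[OF l F] mix_ratio(2,3)[OF l]])
  have "mix_inv \<mu>1 \<mu>2 l F (y - \<mu>2) = 1 / (1 - l) * (\<Sum>k. ?a k)"
    by (simp add: mix_inv_def translate_def algebra_simps)
  moreover have "l * mix_inv \<mu>1 \<mu>2 l F (y - \<mu>1) = - (\<Sum>k. ?a (Suc k))"
  proof -
    have s': "summable (\<lambda>k. ?\<rho> ^ k * F (y + real (Suc k) * (\<mu>2 - \<mu>1)))"
      by (rule abs_suminf_le_geometric(1)[OF mix_inv_summand_le[OF l F] mix_ratio(2,3)[OF l]])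
    have "l * mix_inv \<mu>1 \<mu>2 l F (y - \<mu>1) =
        - (?\<rho> * (\<Sum>k. ?\<rho> ^ k * F (y + real (Suc k) * (\<mu>2 - \<mu>1))))"
      by (simp add: mix_inv_def translate_def algebra_simps)
    also have "\<dots> = - (\<Sum>k. ?a (Suc k))"
      using suminf_mult[OF s', of ?\<rho>] by (simp add: mult.assoc)
    finally show ?thesis .
  qed
  moreover have "(\<Sum>k. ?a (Suc k)) = (\<Sum>k. ?a k) - F y"
    using suminf_split_head[OF s] by simp
  ultimately show "mix_op \<mu>1 \<mu>2 l (mix_inv \<mu>1 \<mu>2 l F) y = F y"
    using l by (simp add: mix_op_def translate_def field_simps)
qed

lemma sym_mix_eq:
  "sym_mix \<mu>1 \<mu>2 l F x = 1 - l * mix_inv \<mu>1 \<mu>2 l F (\<mu>1 - x) - (1 - l) * mix_inv \<mu>1 \<mu>2 l F (\<mu>2 - x)"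
  by (simp add: sym_mix_def mix_op_def refl_op_def translate_def algebra_simps)

lemma convex_comb_abs_le:
  fixes l a b c :: real
  assumes "0 \<le> l" "l \<le> 1" "\<bar>a\<bar> \<le> c" "\<bar>b\<bar> \<le> c"
  shows "\<bar>l * a + (1 - l) * b\<bar> \<le> c"
proof -
  have "\<bar>l * a + (1 - l) * b\<bar> \<le> l * \<bar>a\<bar> + (1 - l) * \<bar>b\<bar>"
    using assms abs_triangle_ineq[of "l * a" "(1 - l) * b"] by (simp add: abs_mult)
  also have "\<dots> \<le> l * c + (1 - l) * c"
    using assms by (intro add_mono mult_left_mono) auto
  finally show ?thesis by (simp add: algebra_simps)
qed

lemma abs_sym_mix_le:
  assumes l: "0 \<le> l" "l < 1/2" and F: "\<And>x. \<bar>F x\<bar> \<le> B"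
  shows "\<bar>sym_mix \<mu>1 \<mu>2 l F x\<bar> \<le> 1 + B / (1 - 2 * l)"
proof -
  have "\<bar>l * mix_inv \<mu>1 \<mu>2 l F (\<mu>1 - x) + (1 - l) * mix_inv \<mu>1 \<mu>2 l F (\<mu>2 - x)\<bar> \<le> B / (1 - 2 * l)"
    using l by (intro convex_comb_abs_le abs_mix_inv_le F) auto
  then show ?thesis
    unfolding sym_mix_eq by linarith
qed

text \<open>The operator on the left is the adjoint of \<^const>\<open>mix_op\<close>.\<close>

lemma adjoint_sym_mix:
  assumes l: "0 \<le> l" "l < 1/2" and F: "\<And>x. \<bar>F x\<bar> \<le> B"
  shows "l * sym_mix \<mu>1 \<mu>2 l F (x + \<mu>1) + (1 - l) * sym_mix \<mu>1 \<mu>2 l F (x + \<mu>2) =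
    1 - l * F (\<mu>1 - x) - (1 - l) * F (\<mu>2 - x)"
proof -
  have H: "l * mix_inv \<mu>1 \<mu>2 l F (y - \<mu>1) + (1 - l) * mix_inv \<mu>1 \<mu>2 l F (y - \<mu>2) = F y" for y
    using fun_cong[OF mix_op_mix_inv[OF l, where F = F, OF F], of \<mu>1 \<mu>2 y]
    by (simp add: mix_op_def translate_def)
  \<comment> \<open>Written through the inverse applied to \<open>F\<close>, both sides are the same
    combination of its values at three points: \<open>- x\<close> and its two shifts by
    \<open>\<mu>2 - \<mu>1\<close> up and down.\<close>
  show ?thesis
    unfolding sym_mix_eq H[of "\<mu>1 - x", symmetric] H[of "\<mu>2 - x", symmetric]
    by (simp add: algebra_simps)
qed

text \<open>The weight \<open>1 - l\<close> exceeds \<open>l\<close>. Solving the combination for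
  the heavier term gives \<open>U \<le> (V + l * U) / (1 - l)\<close> for the supremum
  \<open>U\<close> of \<open>\<bar>u x\<bar>\<close>, which \<open>B\<close> guarantees to be
  finite.\<close>

lemma adjoint_sup_bound:
  fixes u :: "real \<Rightarrow> real"
  assumes l: "0 \<le> l" "l < 1/2" and u: "\<And>x. \<bar>u x\<bar> \<le> B"
    and V: "\<And>x. \<bar>l * u (x + a) + (1 - l) * u (x + b)\<bar> \<le> V"
  shows "\<bar>u x\<bar> \<le> V / (1 - 2 * l)"
proof -
  define U where "U = (SUP x. \<bar>u x\<bar>)"
  have bdd: "bdd_above (range (\<lambda>x. \<bar>u x\<bar>))"
    using u by (auto intro!: bdd_aboveI2)
  have le_U: "\<bar>u x\<bar> \<le> U" for x
    unfolding U_def by (rule cSUP_upper[OF _ bdd]) simp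
  have "\<bar>u x\<bar> \<le> (V + l * U) / (1 - l)" for x
  proof -
    have "(1 - l) * \<bar>u x\<bar> = \<bar>(l * u (x - b + a) + (1 - l) * u (x - b + b)) - l * u (x - b + a)\<bar>"
      using l by (simp add: abs_mult)
    also have "\<dots> \<le> V + \<bar>l * u (x - b + a)\<bar>"
      using V[of "x - b"] by linarith
    also have "\<dots> \<le> V + l * U"
      using l le_U by (simp add: abs_mult mult_left_mono)
    finally show ?thesis using l by (simp add: field_simps)
  qed
  then have "U \<le> (V + l * U) / (1 - l)"
    unfolding U_def by (intro cSUP_least) auto
  then have "U \<le> V / (1 - 2 * l)"
    using l by (simp add: field_simps)
  with le_U[of x] show ?thesis by linarith
qed

text \<open>This is nonnegativity of the weighted variance about the weighted mean
  \<open>m\<close>.\<close>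

lemma suminf_cauchy_schwarz:
  fixes w u :: "nat \<Rightarrow> real"
  assumes w: "summable w" "\<And>k. 0 \<le> w k" "0 < suminf w"
    and s: "summable (\<lambda>k. w k * u k)" "summable (\<lambda>k. w k * (u k)\<^sup>2)"
  shows "(\<Sum>k. w k * u k)\<^sup>2 \<le> suminf w * (\<Sum>k. w k * (u k)\<^sup>2)"
proof -
  define m where "m = (\<Sum>k. w k * u k) / suminf w"
  have eq: "w k * (u k - m)\<^sup>2 = w k * (u k)\<^sup>2 - 2 * m * (w k * u k) + m\<^sup>2 * w k" for k
    by (simp add: power2_eq_square algebra_simps)
  have "(\<lambda>k. w k * (u k - m)\<^sup>2) sums
      ((\<Sum>k. w k * (u k)\<^sup>2) - 2 * m * (\<Sum>k. w k * u k) + m\<^sup>2 * suminf w)"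
    unfolding eq using w s by (intro sums_add sums_diff sums_mult summable_sums)
  moreover have "0 \<le> w k * (u k - m)\<^sup>2" for k
    using w by simp
  ultimately have "0 \<le> (\<Sum>k. w k * (u k)\<^sup>2) - 2 * m * (\<Sum>k. w k * u k) + m\<^sup>2 * suminf w"
    by (rule sums_le[OF _ sums_zero, rotated])
  also have "\<dots> = (\<Sum>k. w k * (u k)\<^sup>2) - (\<Sum>k. w k * u k)\<^sup>2 / suminf w"
    using w(3) by (simp add: m_def power2_eq_square)
  finally show ?thesis using w(3) by (simp add: field_simps)
qed

text \<open>On the parameter interval \<open>l / (1 - l)\<close> is at most \<open>q\<close>, its
  value at \<open>l = 1/2 - d\<close>, so the bound is free of \<open>l\<close>. The factor 2 bounds
  \<open>1 / (1 - l)\<close>; the summand \<open>2 / q\<close> pays for the series at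
  \<open>\<mu>2 - x\<close>, which starts one index later than the one at
  \<open>\<mu>1 - x\<close>.\<close>

lemma abs_sym_mix_diff_le:
  fixes d :: real
  defines "q \<equiv> (1/2 - d) / (1/2 + d)"
  assumes d: "0 < d" "d < 1/2" and l: "l \<in> {0..1/2 - d}"
    and F: "\<And>x. \<bar>F x\<bar> \<le> B" and G: "\<And>x. \<bar>G x\<bar> \<le> B"
  shows "\<bar>sym_mix \<mu>1 \<mu>2 l F x - sym_mix \<mu>1 \<mu>2 l G x\<bar> \<le>
    (2 + 2 / q) * (\<Sum>k. q ^ k * \<bar>F (\<mu>1 + \<mu>2 + real k * (\<mu>2 - \<mu>1) - x) - G (\<mu>1 + \<mu>2 + real k * (\<mu>2 - \<mu>1) - x)\<bar>)"
proof -
  have q: "0 < q" "q < 1"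
    using d by (auto simp: q_def field_simps)
  have l': "0 \<le> l" "l < 1/2"
    using l d by auto
  have lq: "l / (1 - l) \<le> q"
    unfolding q_def using l d by (intro frac_le) auto
  define D where "D = (\<lambda>y. \<bar>F y - G y\<bar>)"
  have D: "\<bar>D y\<bar> \<le> 2 * B" for y
    unfolding D_def using F[of y] G[of y] by linarith
  have summ: "summable (\<lambda>k. q ^ k * D (c k))" for c :: "nat \<Rightarrow> real"
    by (rule abs_suminf_le_geometric(1)[where p = q and B = "2 * B"])
      (use q D in \<open>auto simp: abs_mult intro!: mult_left_mono\<close>)
  have inv: "\<bar>mix_inv \<mu>1 \<mu>2 l F y - mix_inv \<mu>1 \<mu>2 l G y\<bar> \<le>
      2 * (\<Sum>k. q ^ k * D (y + \<mu>2 + real k * (\<mu>2 - \<mu>1)))" for y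
  proof -
    let ?\<rho> = "- l / (1 - l)"
    let ?c = "\<lambda>k. y + \<mu>2 + real k * (\<mu>2 - \<mu>1)"
    have sF: "summable (\<lambda>k. ?\<rho> ^ k * F (?c k))" and sG: "summable (\<lambda>k. ?\<rho> ^ k * G (?c k))"
      by (rule abs_suminf_le_geometric(1)[OF mix_inv_summand_le[OF l'] mix_ratio(2,3)[OF l']],
          rule F G)+
    have le: "\<bar>?\<rho> ^ k * (F (?c k) - G (?c k))\<bar> \<le> q ^ k * D (?c k)" for k
      unfolding abs_mult power_abs mix_ratio(1)[OF l'] D_def
      using mix_ratio(2)[OF l'] lq by (intro mult_right_mono power_mono) auto
    have sa: "summable (\<lambda>k. \<bar>?\<rho> ^ k * (F (?c k) - G (?c k))\<bar>)"
      by (rule summable_comparison_test'[OF summ, of 0]) (use le in auto)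
    have diff: "mix_inv \<mu>1 \<mu>2 l F y - mix_inv \<mu>1 \<mu>2 l G y =
        1 / (1 - l) * (\<Sum>k. ?\<rho> ^ k * (F (?c k) - G (?c k)))"
    proof -
      have eq: "mix_inv \<mu>1 \<mu>2 l H y = 1 / (1 - l) * (\<Sum>k. ?\<rho> ^ k * H (?c k))" for H
        by (simp add: mix_inv_def translate_def algebra_simps)
      have "(\<lambda>k. ?\<rho> ^ k * (F (?c k) - G (?c k))) = (\<lambda>k. ?\<rho> ^ k * F (?c k) - ?\<rho> ^ k * G (?c k))"
        by (rule ext) (rule right_diff_distrib)
      then have sd: "(\<Sum>k. ?\<rho> ^ k * (F (?c k) - G (?c k))) =
          (\<Sum>k. ?\<rho> ^ k * F (?c k)) - (\<Sum>k. ?\<rho> ^ k * G (?c k))"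
        by (simp only: suminf_diff[OF sF sG])
      show ?thesis
        unfolding eq[of F] eq[of G] sd by (rule right_diff_distrib[symmetric])
    qed
    show ?thesis
      unfolding diff abs_mult
    proof (rule mult_mono)
      show "\<bar>1 / (1 - l)\<bar> \<le> 2"
        using l' by (simp add: field_simps)
      show "\<bar>\<Sum>k. ?\<rho> ^ k * (F (?c k) - G (?c k))\<bar> \<le> (\<Sum>k. q ^ k * D (?c k))"
        by (rule order_trans[OF summable_rabs[OF sa] suminf_le[OF le sa summ]])
    qed auto
  qed
  define e where "e = (\<lambda>k. \<mu>1 + \<mu>2 + real k * (\<mu>2 - \<mu>1) - x)"
  let ?S = "\<Sum>k. q ^ k * D (e k)"
  have S0: "0 \<le> ?S"
    using q by (intro suminf_nonneg summ) (auto simp: D_def)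
  \<comment> \<open>Dropping the nonnegative head bounds the shifted series at the cost of a factor
    \<open>1 / q\<close>.\<close>
  have "q * (\<Sum>k. q ^ k * D (e (Suc k))) = ?S - D (e 0)"
    using suminf_split_head[OF summ, of e] suminf_mult[OF summ, of q "\<lambda>k. e (Suc k)"]
    by (simp add: mult.assoc)
  moreover have "0 \<le> D (e 0)"
    by (simp add: D_def)
  ultimately have "q * (\<Sum>k. q ^ k * D (e (Suc k))) \<le> ?S"
    by linarith
  then have shift: "(\<Sum>k. q ^ k * D (e (Suc k))) \<le> ?S / q"
    using q by (simp add: field_simps)
  have 1: "\<bar>mix_inv \<mu>1 \<mu>2 l F (\<mu>1 - x) - mix_inv \<mu>1 \<mu>2 l G (\<mu>1 - x)\<bar> \<le> (2 + 2 / q) * ?S"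
  proof -
    have "\<bar>mix_inv \<mu>1 \<mu>2 l F (\<mu>1 - x) - mix_inv \<mu>1 \<mu>2 l G (\<mu>1 - x)\<bar> \<le> 2 * ?S"
      using inv[of "\<mu>1 - x"] by (simp add: e_def algebra_simps)
    also have "\<dots> \<le> (2 + 2 / q) * ?S"
      using S0 q by (intro mult_right_mono) auto
    finally show ?thesis .
  qed
  have 2: "\<bar>mix_inv \<mu>1 \<mu>2 l F (\<mu>2 - x) - mix_inv \<mu>1 \<mu>2 l G (\<mu>2 - x)\<bar> \<le> (2 + 2 / q) * ?S"
  proof -
    have "\<bar>mix_inv \<mu>1 \<mu>2 l F (\<mu>2 - x) - mix_inv \<mu>1 \<mu>2 l G (\<mu>2 - x)\<bar> \<le>
        2 * (\<Sum>k. q ^ k * D (e (Suc k)))"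
      using inv[of "\<mu>2 - x"] by (simp add: e_def algebra_simps)
    also have "\<dots> \<le> 2 * (?S / q)"
      using shift by simp
    also have "\<dots> \<le> (2 + 2 / q) * ?S"
      using S0 by (simp add: algebra_simps)
    finally show ?thesis .
  qed
  have "\<bar>sym_mix \<mu>1 \<mu>2 l F x - sym_mix \<mu>1 \<mu>2 l G x\<bar> =
    \<bar>l * (mix_inv \<mu>1 \<mu>2 l F (\<mu>1 - x) - mix_inv \<mu>1 \<mu>2 l G (\<mu>1 - x)) +
     (1 - l) * (mix_inv \<mu>1 \<mu>2 l F (\<mu>2 - x) - mix_inv \<mu>1 \<mu>2 l G (\<mu>2 - x))\<bar>"
    unfolding sym_mix_eq by (simp add: algebra_simps)
  also have "\<dots> \<le> (2 + 2 / q) * ?S"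
    using l' 1 2 by (intro convex_comb_abs_le) auto
  finally show ?thesis
    by (simp add: e_def D_def)
qed

section \<open>Identifiability and the deterministic bound\<close>

text \<open>Through this the Lebesgue-Stieltjes integral in \<open>contrast\<close> becomes an
  integral against the distribution itself.\<close>

lemma (in real_distribution) interval_measure_cdf: "interval_measure (cdf M) = M"
proof (rule cdf_unique)
  show "real_distribution (interval_measure (cdf M))"
    by (intro real_distribution_interval_measure cdf_nondecreasing cdf_is_right_cont
        cdf_lim_at_bot cdf_lim_at_top_prob)
  show "cdf (interval_measure (cdf M)) = cdf M"
    by (intro cdf_interval_measure cdf_nondecreasing cdf_is_right_cont cdf_lim_at_bot)
qed (rule real_distribution_axioms)

lemma (in finite_borel_measure) borel_measurable_cdf: "cdf M \<in> borel_measurable borel"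
  by (intro borel_measurable_mono) (auto simp: mono_def cdf_nondecreasing)

lemma borel_measurable_sym_mix:
  assumes [measurable]: "F \<in> borel_measurable borel"
  shows "sym_mix \<mu>1 \<mu>2 l F \<in> borel_measurable borel"
  unfolding sym_mix_def mix_op_def refl_op_def mix_inv_def translate_def by measurable

section \<open>The true mixture and its defect\<close>

locale symmetric_mixture =
  fixes F0 :: "real \<Rightarrow> real" and \<mu>1 \<mu>2 l0 L d :: real
  assumes F0_01: "0 \<le> F0 x" "F0 x \<le> 1"
    and F0_sym: "F0 (- x) = 1 - F0 x"
    and F0_strict: "strict_mono F0"
    and F0_lip: "\<bar>F0 x - F0 y\<bar> \<le> L * \<bar>x - y\<bar>"
    and L_pos: "0 < L"
    and d: "0 < d" "d < 1/2"
    and l0: "l0 \<in> {0..1/2 - d}"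
    and \<mu>_neq: "\<mu>1 \<noteq> \<mu>2"
begin

definition G :: "real \<Rightarrow> real" where
  "G = mix_op \<mu>1 \<mu>2 l0 F0"

text \<open>The residual that \<open>contrast\<close> squares, taken at the true c.d.f.\<close>

definition defect :: "real \<Rightarrow> real \<Rightarrow> real" where
  "defect l x = sym_mix \<mu>1 \<mu>2 l G x - G x"

lemma G_eq: "G x = l0 * F0 (x - \<mu>1) + (1 - l0) * F0 (x - \<mu>2)"
  by (simp add: G_def mix_op_def translate_def)

lemma abs_G_le: "\<bar>G x\<bar> \<le> 1"
  unfolding G_eq using l0 d F0_01 by (intro convex_comb_abs_le) auto

lemma G_lip: "\<bar>G x - G y\<bar> \<le> L * \<bar>x - y\<bar>"
proof -
  have "\<bar>l0 * (F0 (x - \<mu>1) - F0 (y - \<mu>1)) + (1 - l0) * (F0 (x - \<mu>2) - F0 (y - \<mu>2))\<bar> \<le> L * \<bar>x - y\<bar>"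
    using l0 d F0_lip[of "x - \<mu>1" "y - \<mu>1"] F0_lip[of "x - \<mu>2" "y - \<mu>2"]
    by (intro convex_comb_abs_le) auto
  then show ?thesis
    by (simp add: G_eq algebra_simps)
qed

lemma G_strict: "x < y \<Longrightarrow> G x < G y"
proof -
  assume "x < y"
  then have "F0 (x - \<mu>1) < F0 (y - \<mu>1)" "F0 (x - \<mu>2) < F0 (y - \<mu>2)"
    using F0_strict by (auto simp: strict_mono_def)
  then have "l0 * F0 (x - \<mu>1) \<le> l0 * F0 (y - \<mu>1)" "(1 - l0) * F0 (x - \<mu>2) < (1 - l0) * F0 (y - \<mu>2)"
    using l0 d by (auto intro!: mult_left_mono)
  then show ?thesis
    unfolding G_eq by linarith
qed

text \<open>Symmetry turns every reflected value of \<open>F0\<close> into one at \<open>x\<close>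
  or at \<open>x\<close> shifted by \<open>\<mu>2 - \<mu>1\<close> up or down. The terms in
  \<open>F0 x\<close> cancel, and the shifted values carry the coefficient
  \<open>l * (1 - l0) - l0 * (1 - l) = l - l0\<close> up to sign.\<close>

lemma adjoint_defect:
  assumes l: "0 \<le> l" "l < 1/2"
  shows "l * defect l (x + \<mu>1) + (1 - l) * defect l (x + \<mu>2) =
    (l - l0) * (F0 (x + (\<mu>2 - \<mu>1)) - F0 (x - (\<mu>2 - \<mu>1)))"
proof -
  have e: "F0 (\<mu>1 - x - \<mu>1) = 1 - F0 x" "F0 (\<mu>2 - x - \<mu>2) = 1 - F0 x"
    "F0 (\<mu>1 - x - \<mu>2) = 1 - F0 (x + (\<mu>2 - \<mu>1))"
    "F0 (\<mu>2 - x - \<mu>1) = 1 - F0 (x - (\<mu>2 - \<mu>1))"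
    using F0_sym[of x] F0_sym[of "x + (\<mu>2 - \<mu>1)"] F0_sym[of "x - (\<mu>2 - \<mu>1)"]
    by (simp_all add: algebra_simps)
  have e': "x + \<mu>1 - \<mu>1 = x" "x + \<mu>2 - \<mu>2 = x"
    "x + \<mu>1 - \<mu>2 = x - (\<mu>2 - \<mu>1)" "x + \<mu>2 - \<mu>1 = x + (\<mu>2 - \<mu>1)"
    by auto
  have "l * defect l (x + \<mu>1) + (1 - l) * defect l (x + \<mu>2) =
    (l * sym_mix \<mu>1 \<mu>2 l G (x + \<mu>1) + (1 - l) * sym_mix \<mu>1 \<mu>2 l G (x + \<mu>2))
    - (l * G (x + \<mu>1) + (1 - l) * G (x + \<mu>2))"
    by (simp add: defect_def algebra_simps)
  also have "\<dots> = 1 - l * G (\<mu>1 - x) - (1 - l) * G (\<mu>2 - x) - (l * G (x + \<mu>1) + (1 - l) * G (x + \<mu>2))"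
    by (simp only: adjoint_sym_mix[OF l, where F = G, OF abs_G_le])
  also have "\<dots> = (l - l0) * (F0 (x + (\<mu>2 - \<mu>1)) - F0 (x - (\<mu>2 - \<mu>1)))"
    unfolding G_eq e e' by algebra
  finally show ?thesis .
qed

lemma abs_defect_le:
  assumes l: "0 \<le> l" "l < 1/2"
  shows "\<bar>defect l x\<bar> \<le> 2 + 1 / (1 - 2 * l)"
  using abs_sym_mix_le[OF l, where F = G, OF abs_G_le, of \<mu>1 \<mu>2 x] abs_G_le[of x] unfolding defect_def by linarith

text \<open>At \<open>l0\<close> the adjoint sends the defect to zero, so the sup bound applies with
  \<open>V = 0\<close>.\<close>

lemma defect_true [simp]: "defect l0 x = 0"
proof -
  have l: "0 \<le> l0" "l0 < 1/2"
    using l0 d by auto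
  have "\<bar>defect l0 x\<bar> \<le> 0 / (1 - 2 * l0)"
    by (rule adjoint_sup_bound[where a = \<mu>1 and b = \<mu>2, OF l, where u = "defect l0", OF abs_defect_le[OF l]])
      (simp add: adjoint_defect[OF l])
  then show ?thesis by simp
qed

text \<open>The sup bound is applied to an increment of the defect, whose adjoint image is
  \<open>l - l0\<close> times increments of \<open>F0\<close>; \<open>d\<close> enters through
  \<open>1 - 2 * l \<ge> 2 * d\<close>. Keeping the factor \<open>\<bar>l - l0\<bar>\<close> is what
  later allows a window whose radius is independent of \<open>l\<close>.\<close>

lemma defect_lip:
  assumes l: "l \<in> {0..1/2 - d}"
  shows "\<bar>defect l x - defect l y\<bar> \<le> \<bar>l - l0\<bar> * (L * \<bar>x - y\<bar> / d)"
proof -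
  have l': "0 \<le> l" "l < 1/2"
    using l d by auto
  define u where "u z = defect l (z + (x - y)) - defect l z" for z
  have "\<bar>u y\<bar> \<le> \<bar>l - l0\<bar> * (2 * L * \<bar>x - y\<bar>) / (1 - 2 * l)"
  proof (rule adjoint_sup_bound[where u = u and a = \<mu>1 and b = \<mu>2, OF l'])
    show "\<bar>u z\<bar> \<le> 2 * (2 + 1 / (1 - 2 * l))" for z
      using abs_defect_le[OF l', of z] abs_defect_le[OF l', of "z + (x - y)"] unfolding u_def
      by (smt (verit))
    fix z
    let ?s = "x - y" and ?\<eta> = "\<mu>2 - \<mu>1"
    have "l * u (z + \<mu>1) + (1 - l) * u (z + \<mu>2) =
      (l * defect l ((z + ?s) + \<mu>1) + (1 - l) * defect l ((z + ?s) + \<mu>2))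
      - (l * defect l (z + \<mu>1) + (1 - l) * defect l (z + \<mu>2))"
      by (simp add: u_def algebra_simps)
    also have "\<dots> = (l - l0) * ((F0 (z + ?s + ?\<eta>) - F0 (z + ?\<eta>)) - (F0 (z + ?s - ?\<eta>) - F0 (z - ?\<eta>)))"
      unfolding adjoint_defect[OF l'] by (simp add: algebra_simps)
    also have "\<bar>\<dots>\<bar> \<le> \<bar>l - l0\<bar> * (2 * L * \<bar>x - y\<bar>)"
      unfolding abs_mult
    proof (rule mult_left_mono)
      show "\<bar>F0 (z + ?s + ?\<eta>) - F0 (z + ?\<eta>) - (F0 (z + ?s - ?\<eta>) - F0 (z - ?\<eta>))\<bar> \<le> 2 * L * \<bar>?s\<bar>"
        using F0_lip[of "z + ?s + ?\<eta>" "z + ?\<eta>"] F0_lip[of "z + ?s - ?\<eta>" "z - ?\<eta>"] by simp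
    qed simp
    finally show "\<bar>l * u (z + \<mu>1) + (1 - l) * u (z + \<mu>2)\<bar> \<le> \<bar>l - l0\<bar> * (2 * L * \<bar>x - y\<bar>)" .
  qed
  also have "\<dots> \<le> \<bar>l - l0\<bar> * (2 * L * \<bar>x - y\<bar>) / (2 * d)"
    using l d L_pos by (intro divide_left_mono) auto
  finally show ?thesis
    by (simp add: u_def)
qed

text \<open>The size of the last factor of \<open>adjoint_defect\<close> at \<open>x = 0\<close>,
  the point where the left side involves exactly \<open>\<mu>1\<close> and
  \<open>\<mu>2\<close>.\<close>

definition \<delta> :: real where
  "\<delta> = \<bar>F0 (\<mu>2 - \<mu>1) - F0 (\<mu>1 - \<mu>2)\<bar>"

lemma \<delta>_pos: "0 < \<delta>"
  using \<mu>_neq strict_mono_eq[OF F0_strict, of "\<mu>2 - \<mu>1" "\<mu>1 - \<mu>2"] unfolding \<delta>_def by auto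

text \<open>A convex combination of two numbers cannot exceed both in absolute value. Which of the
  two points is obtained may depend on \<open>l\<close>.\<close>

lemma defect_large:
  assumes l: "l \<in> {0..1/2 - d}"
  obtains \<mu> where "\<mu> = \<mu>1 \<or> \<mu> = \<mu>2" "\<bar>l - l0\<bar> * \<delta> \<le> \<bar>defect l \<mu>\<bar>"
proof -
  have l': "0 \<le> l" "l < 1/2"
    using l d by auto
  have "l * defect l \<mu>1 + (1 - l) * defect l \<mu>2 = (l - l0) * (F0 (\<mu>2 - \<mu>1) - F0 (\<mu>1 - \<mu>2))"
    using adjoint_defect[OF l', of 0] by simp
  then have "\<bar>l - l0\<bar> * \<delta> \<le> max \<bar>defect l \<mu>1\<bar> \<bar>defect l \<mu>2\<bar>"
    using convex_comb_abs_le[of l "defect l \<mu>1" "max \<bar>defect l \<mu>1\<bar> \<bar>defect l \<mu>2\<bar>" "defect l \<mu>2"] l'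
    by (simp add: abs_mult \<delta>_def)
  then show ?thesis
    using that[of \<mu>1] that[of \<mu>2] by (auto simp: max_def split: if_splits)
qed

section \<open>Control of the residual uniformly in the weight\<close>

definition q :: real where
  "q = (1/2 - d) / (1/2 + d)"

definition e :: "nat \<Rightarrow> real" where
  "e k = \<mu>1 + \<mu>2 + real k * (\<mu>2 - \<mu>1)"

text \<open>Collects the squared deviations at all points that the residual at \<open>x\<close>
  reads: \<open>x\<close> itself and the reflected points of the Neumann series. The weights
  \<open>q ^ k\<close> replace those depending on \<open>l\<close>.\<close>

definition dev :: "(real \<Rightarrow> real) \<Rightarrow> real \<Rightarrow> real" where
  "dev D x = (D x)\<^sup>2 + (\<Sum>k. q ^ k * (D (e k - x))\<^sup>2)"

lemma q: "0 < q" "q < 1"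
  using d by (auto simp: q_def field_simps)

lemma dev_series:
  assumes D: "\<And>x. \<bar>D x\<bar> \<le> B"
  shows "summable (\<lambda>k. q ^ k * (D (e k - x))\<^sup>2)" "\<bar>\<Sum>k. q ^ k * (D (e k - x))\<^sup>2\<bar> \<le> B\<^sup>2 / (1 - q)"
proof -
  have "(D y)\<^sup>2 \<le> B\<^sup>2" for y
    using D[of y] by (metis abs_ge_zero power2_abs power_mono)
  then have "\<bar>q ^ k * (D (e k - x))\<^sup>2\<bar> \<le> q ^ k * B\<^sup>2" for k
    using q by (simp add: abs_mult mult_left_mono)
  from abs_suminf_le_geometric[OF this] q
  show "summable (\<lambda>k. q ^ k * (D (e k - x))\<^sup>2)" "\<bar>\<Sum>k. q ^ k * (D (e k - x))\<^sup>2\<bar> \<le> B\<^sup>2 / (1 - q)"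
    by auto
qed

lemma dev_le:
  assumes D: "\<And>x. \<bar>D x\<bar> \<le> B"
  shows "dev D x \<le> (1 + 1 / (1 - q)) * B\<^sup>2"
proof -
  have "(D x)\<^sup>2 \<le> B\<^sup>2"
    using D[of x] by (metis abs_ge_zero power2_abs power_mono)
  then show ?thesis
    using dev_series(2)[where D = D, OF D, of x] by (simp add: dev_def algebra_simps)
qed

lemma dev_nonneg:
  assumes D: "\<And>x. \<bar>D x\<bar> \<le> B"
  shows "0 \<le> dev D x"
  unfolding dev_def using q by (intro add_nonneg_nonneg suminf_nonneg dev_series[where D = D, OF D]) auto

lemma borel_measurable_dev:
  assumes [measurable]: "D \<in> borel_measurable borel"
  shows "dev D \<in> borel_measurable borel"
  unfolding dev_def by measurable

lemma borel_measurable_G [measurable]: "G \<in> borel_measurable borel"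
  by (intro borel_measurable_mono monoI) (metis G_strict le_less)

text \<open>The factors 2 come from
  \<open>(a + b)\<^sup>2 \<le> 2 * a\<^sup>2 + 2 * b\<^sup>2\<close>, and \<open>1 / (1 - q)\<close>
  is the total weight in Cauchy-Schwarz.\<close>

definition K :: real where
  "K = 2 + 2 * (2 + 2 / q)\<^sup>2 / (1 - q)"

lemma K_pos: "0 < K"
  unfolding K_def using q by (intro add_pos_nonneg) auto

text \<open>The difference splits into the change of \<open>sym_mix\<close> and the deviation at
  \<open>x\<close>. Cauchy-Schwarz passes from the weighted sum of absolute deviations to one of
  squares, whose expectations can be computed.\<close>

lemma residual_minus_defect_le:
  assumes l: "l \<in> {0..1/2 - d}" and F: "\<And>x. \<bar>F x\<bar> \<le> 1"
  shows "((sym_mix \<mu>1 \<mu>2 l F x - F x) - defect l x)\<^sup>2 \<le> K * dev (\<lambda>x. F x - G x) x"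
proof -
  define D where "D = (\<lambda>x. F x - G x)"
  have D: "\<bar>D y\<bar> \<le> 2" for y
    unfolding D_def using F[of y] abs_G_le[of y] by linarith
  define S where "S = (\<Sum>k. q ^ k * \<bar>D (e k - x)\<bar>)"
  define S2 where "S2 = (\<Sum>k. q ^ k * (D (e k - x))\<^sup>2)"
  let ?B = "2 + 2 / q"
  have "\<bar>sym_mix \<mu>1 \<mu>2 l F x - sym_mix \<mu>1 \<mu>2 l G x\<bar> \<le> ?B * S"
    unfolding S_def D_def e_def q_def by (rule abs_sym_mix_diff_le[OF d l F abs_G_le])
  moreover have "(sym_mix \<mu>1 \<mu>2 l F x - F x) - defect l x =
      (sym_mix \<mu>1 \<mu>2 l F x - sym_mix \<mu>1 \<mu>2 l G x) - D x"
    by (simp add: defect_def D_def)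
  ultimately have le: "\<bar>(sym_mix \<mu>1 \<mu>2 l F x - F x) - defect l x\<bar> \<le> \<bar>D x\<bar> + ?B * S"
    by linarith
  have w: "summable ((^) q)" "suminf ((^) q) = 1 / (1 - q)"
    using q by (auto intro!: summable_geometric suminf_geometric)
  have sS: "summable (\<lambda>k. q ^ k * \<bar>D (e k - x)\<bar>)"
    by (rule abs_suminf_le_geometric(1)[where p = q and B = 2])
      (use q D in \<open>auto simp: abs_mult intro!: mult_left_mono\<close>)
  have S: "S\<^sup>2 \<le> 1 / (1 - q) * S2"
    using suminf_cauchy_schwarz[OF w(1), of "\<lambda>k. \<bar>D (e k - x)\<bar>"] q sS dev_series(1)[where D = D, OF D]
    unfolding S_def S2_def w(2) by simp
  have "((sym_mix \<mu>1 \<mu>2 l F x - F x) - defect l x)\<^sup>2 \<le> (\<bar>D x\<bar> + ?B * S)\<^sup>2"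
    using le by (metis abs_ge_zero power2_abs power_mono)
  also have "\<dots> \<le> 2 * (D x)\<^sup>2 + 2 * ?B\<^sup>2 * S\<^sup>2"
  proof -
    have "(a + b)\<^sup>2 \<le> 2 * a\<^sup>2 + 2 * b\<^sup>2" for a b :: real
      using zero_le_power2[of "a - b"] by (simp add: power2_diff power2_sum)
    from this[of "\<bar>D x\<bar>" "?B * S"] show ?thesis
      by (simp only: power_mult_distrib power2_abs mult.assoc)
  qed
  also have "\<dots> \<le> 2 * (D x)\<^sup>2 + 2 * ?B\<^sup>2 * (1 / (1 - q) * S2)"
    using S by (intro add_left_mono mult_left_mono) auto
  also have "\<dots> \<le> K * ((D x)\<^sup>2 + S2)"
  proof -
    have "0 \<le> S2"
      unfolding S2_def using q by (intro suminf_nonneg dev_series[where D = D, OF D]) auto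
    moreover have "0 \<le> 2 * ?B\<^sup>2 / (1 - q)"
      using q by simp
    ultimately have "0 \<le> 2 * S2 + (2 * ?B\<^sup>2 / (1 - q)) * (D x)\<^sup>2"
      by (intro add_nonneg_nonneg mult_nonneg_nonneg) auto
    moreover have "K * ((D x)\<^sup>2 + S2) = 2 * (D x)\<^sup>2 + 2 * ?B\<^sup>2 * (1 / (1 - q) * S2) +
        (2 * S2 + (2 * ?B\<^sup>2 / (1 - q)) * (D x)\<^sup>2)"
      unfolding K_def by (simp add: distrib_left distrib_right)
    ultimately show ?thesis by linarith
  qed
  finally show ?thesis
    by (simp add: D_def S2_def dev_def)
qed

section \<open>From the contrast to the estimation error\<close>

definition r :: real where
  "r = \<delta> * d / (2 * L)"

text \<open>A lower bound for the true mass of the window of radius \<open>r\<close>, whichever of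
  the two points it surrounds.\<close>

definition m :: real where
  "m = min (G (\<mu>1 + r) - G (\<mu>1 - r)) (G (\<mu>2 + r) - G (\<mu>2 - r))"

text \<open>One summand for each of the two cases that end the proof of
  \<open>arg_min_contrast_bound\<close>.\<close>

definition C :: real where
  "C = 32 * K / (\<delta>\<^sup>2 * m) + 8 / m\<^sup>2"

lemma r_pos: "0 < r"
  unfolding r_def using \<delta>_pos d L_pos by simp

lemma m_pos: "0 < m"
  unfolding m_def using r_pos by (auto intro!: G_strict)

lemma C_pos: "0 < C"
  unfolding C_def using K_pos \<delta>_pos m_pos by (intro add_pos_pos) auto

definition test_points :: "real set" where
  "test_points = {\<mu>1 - r, \<mu>1 + r, \<mu>2 - r, \<mu>2 + r}"

text \<open>Minimality bounds the integrated squared residual at \<open>l\<close> by that at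
  \<open>l0\<close>, hence by deviations alone; so the integrated squared defect is small too. On a
  window about \<open>\<mu>1\<close> or \<open>\<mu>2\<close> the squared defect is at least a
  multiple of \<open>(l - l0)\<^sup>2\<close>, and it remains to see whether \<open>N\<close>
  charges that window.\<close>

lemma arg_min_contrast_bound:
  assumes N: "real_distribution N"
    and l: "is_arg_min (\<lambda>l. contrast \<mu>1 \<mu>2 l (cdf N)) (\<lambda>l. l \<in> {0..1/2 - d}) l"
  defines "D \<equiv> \<lambda>x. cdf N x - G x"
  shows "(l - l0)\<^sup>2 \<le> C * ((LINT x|N. dev D x) + (\<Sum>s\<in>test_points. (D s)\<^sup>2))"
proof -
  interpret N: real_distribution N by (rule N)
  let ?F = "cdf N"
  define W1 where "W1 = (LINT x|N. dev D x)"
  define W2 where "W2 = (\<Sum>s\<in>test_points. (D s)\<^sup>2)"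
  have l_in: "l \<in> {0..1/2 - d}" and l_min: "contrast \<mu>1 \<mu>2 l ?F \<le> contrast \<mu>1 \<mu>2 l0 ?F"
    using l l0 unfolding is_arg_min_def by (auto simp: not_less)
  have F: "\<bar>?F x\<bar> \<le> 1" for x
    using N.cdf_nonneg[of x] N.cdf_bounded_prob[of x] by simp
  have D: "\<bar>D x\<bar> \<le> 2" for x
    unfolding D_def using F[of x] abs_G_le[of x] by linarith
  note [measurable] = N.borel_measurable_cdf borel_measurable_sym_mix
  have D_meas [measurable]: "D \<in> borel_measurable borel"
    unfolding D_def by measurable
  note [measurable] = borel_measurable_dev
  have dev_int: "integrable N (dev D)"
  proof (rule N.integrable_const_bound)
    show "AE x in N. norm (dev D x) \<le> (1 + 1 / (1 - q)) * 2\<^sup>2"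
      using dev_nonneg[where D = D, OF D] dev_le[where D = D, OF D] by (intro AE_I2) simp
  qed measurable
  have W1_nonneg: "0 \<le> W1"
    unfolding W1_def by (intro integral_nonneg_AE) (simp add: dev_nonneg[where D = D, OF D])
  have W2_nonneg: "0 \<le> W2"
    unfolding W2_def by (intro sum_nonneg) simp
  define res where "res = (\<lambda>l x. sym_mix \<mu>1 \<mu>2 l ?F x - ?F x)"
  have res_meas [measurable]: "res l \<in> borel_measurable borel" for l
    unfolding res_def by measurable
  have res_int: "integrable N (\<lambda>x. (res l x)\<^sup>2)" if "l \<in> {0..1/2 - d}" for l
  proof (rule N.integrable_const_bound)
    have "\<bar>res l x\<bar> \<le> 2 + 1 / (1 - 2 * l)" for x
    proof -
      have "\<bar>sym_mix \<mu>1 \<mu>2 l ?F x\<bar> \<le> 1 + 1 / (1 - 2 * l)"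
        using that d by (intro abs_sym_mix_le F) auto
      then show ?thesis
        using F[of x] unfolding res_def by linarith
    qed
    then have "(res l x)\<^sup>2 \<le> (2 + 1 / (1 - 2 * l))\<^sup>2" for x
      by (metis abs_ge_zero power2_abs power_mono)
    then show "AE x in N. norm ((res l x)\<^sup>2) \<le> (2 + 1 / (1 - 2 * l))\<^sup>2"
      by simp
  qed measurable
  have contrast: "contrast \<mu>1 \<mu>2 l ?F = (LINT x|N. (res l x)\<^sup>2)" for l
    by (simp add: contrast_def N.interval_measure_cdf res_def)
  have K: "(res l x - defect l x)\<^sup>2 \<le> K * dev D x" if "l \<in> {0..1/2 - d}" for l x
    using residual_minus_defect_le[OF that F] unfolding res_def D_def .
  have "(LINT x|N. (res l x)\<^sup>2) \<le> (LINT x|N. (res l0 x)\<^sup>2)"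
    using l_min by (simp add: contrast)
  \<comment> \<open>The defect vanishes at \<open>l0\<close>, so the residual there consists of
    deviations only.\<close>
  also have "\<dots> \<le> (LINT x|N. K * dev D x)"
    using K[OF l0] by (intro integral_mono res_int[OF l0] integrable_mult_right dev_int) simp
  also have "\<dots> = K * W1"
    by (simp add: W1_def)
  finally have res_le: "(LINT x|N. (res l x)\<^sup>2) \<le> K * W1" .
  obtain \<mu> where \<mu>: "\<mu> = \<mu>1 \<or> \<mu> = \<mu>2" and large: "\<bar>l - l0\<bar> * \<delta> \<le> \<bar>defect l \<mu>\<bar>"
    using defect_large[OF l_in] by blast
  have lower: "(l - l0)\<^sup>2 * \<delta>\<^sup>2 / 4 \<le> (defect l x)\<^sup>2" if "x \<in> {\<mu> - r<..\<mu> + r}" for x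
  proof -
    have "\<bar>defect l x - defect l \<mu>\<bar> \<le> \<bar>l - l0\<bar> * (L * \<bar>x - \<mu>\<bar> / d)"
      by (rule defect_lip[OF l_in])
    also have "\<dots> \<le> \<bar>l - l0\<bar> * (L * r / d)"
      using that d L_pos by (intro mult_left_mono divide_right_mono) auto
    \<comment> \<open>The radius \<open>r\<close> is chosen so that the defect loses at most half of
      its size at the centre.\<close>
    also have "L * r / d = \<delta> / 2"
      using L_pos d by (simp add: r_def)
    finally have "\<bar>l - l0\<bar> * \<delta> / 2 \<le> \<bar>defect l x\<bar>"
      using large by linarith
    then have "(\<bar>l - l0\<bar> * \<delta> / 2)\<^sup>2 \<le> \<bar>defect l x\<bar>\<^sup>2"
      using \<delta>_pos by (intro power_mono) auto
    then show ?thesis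
      by (simp add: power_mult_distrib power_divide)
  qed
  define p where "p = measure N {\<mu> - r<..\<mu> + r}"
  have "(l - l0)\<^sup>2 * \<delta>\<^sup>2 / 4 * p = (LINT x|N. (l - l0)\<^sup>2 * \<delta>\<^sup>2 / 4 * indicator {\<mu> - r<..\<mu> + r} x)"
    by (simp add: p_def)
  also have "\<dots> \<le> (LINT x|N. 2 * (res l x)\<^sup>2 + 2 * (K * dev D x))"
  proof (rule integral_mono)
    show "integrable N (\<lambda>x. 2 * (res l x)\<^sup>2 + 2 * (K * dev D x))"
      by (intro Bochner_Integration.integrable_add integrable_mult_right res_int[OF l_in] dev_int)
    show "(l - l0)\<^sup>2 * \<delta>\<^sup>2 / 4 * indicator {\<mu> - r<..\<mu> + r} x \<le> 2 * (res l x)\<^sup>2 + 2 * (K * dev D x)" for x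
    proof -
      have "(l - l0)\<^sup>2 * \<delta>\<^sup>2 / 4 * indicator {\<mu> - r<..\<mu> + r} x \<le> (defect l x)\<^sup>2"
        using lower by (auto simp: indicator_def)
      also have "\<dots> \<le> 2 * (res l x)\<^sup>2 + 2 * (res l x - defect l x)\<^sup>2"
        using zero_le_power2[of "2 * res l x - defect l x"]
        by (simp add: power2_diff power_mult_distrib)
      finally show ?thesis
        using K[OF l_in, of x] by linarith
    qed
  qed (simp add: less_top[symmetric])
  also have "\<dots> = 2 * (LINT x|N. (res l x)\<^sup>2) + 2 * (K * W1)"
    using res_int[OF l_in] dev_int by (simp add: W1_def)
  finally have key: "(l - l0)\<^sup>2 * \<delta>\<^sup>2 / 4 * p \<le> 4 * K * W1"
    using res_le by linarith
  have p_eq: "p = ?F (\<mu> + r) - ?F (\<mu> - r)"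
    unfolding p_def using r_pos by (subst N.cdf_diff_eq) auto
  have m_le: "m \<le> G (\<mu> + r) - G (\<mu> - r)"
    using \<mu> by (auto simp: m_def)
  show ?thesis
  proof (cases "m / 2 \<le> p")
    case True
    then have "(l - l0)\<^sup>2 * \<delta>\<^sup>2 / 4 * (m / 2) \<le> (l - l0)\<^sup>2 * \<delta>\<^sup>2 / 4 * p"
      by (intro mult_left_mono) auto
    with key have "(l - l0)\<^sup>2 * \<delta>\<^sup>2 / 4 * (m / 2) \<le> 4 * K * W1"
      by linarith
    then have "(l - l0)\<^sup>2 \<le> 32 * K / (\<delta>\<^sup>2 * m) * W1"
      using \<delta>_pos m_pos by (simp add: field_simps)
    also have "\<dots> \<le> C * (W1 + W2)"
      unfolding C_def using W1_nonneg W2_nonneg K_pos \<delta>_pos m_pos by (intro mult_mono) auto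
    finally show ?thesis
      unfolding W1_def W2_def .
  next
    case False
    \<comment> \<open>Too little mass in the window forces a large deviation at its endpoints. Then
      \<open>W2\<close> is at least \<open>m\<^sup>2 / 8\<close>, and the trivial bound
      \<open>\<bar>l - l0\<bar> \<le> 1\<close> suffices.\<close>
    then have "m / 2 \<le> D (\<mu> - r) - D (\<mu> + r)"
      using m_le unfolding p_eq D_def by linarith
    then have "(m / 2)\<^sup>2 \<le> (D (\<mu> - r) - D (\<mu> + r))\<^sup>2"
      using m_pos by (intro power_mono) auto
    also have "\<dots> \<le> 2 * ((D (\<mu> - r))\<^sup>2 + (D (\<mu> + r))\<^sup>2)"
      using zero_le_power2[of "D (\<mu> - r) + D (\<mu> + r)"] by (simp add: power2_diff power2_sum)
    also have "(D (\<mu> - r))\<^sup>2 + (D (\<mu> + r))\<^sup>2 = (\<Sum>s\<in>{\<mu> - r, \<mu> + r}. (D s)\<^sup>2)"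
      using r_pos by simp
    also have "\<dots> \<le> W2"
      unfolding W2_def using \<mu> by (intro sum_mono2) (auto simp: test_points_def)
    finally have W2: "1 \<le> 8 / m\<^sup>2 * W2"
      using m_pos by (simp add: field_simps)
    have "\<bar>l - l0\<bar> \<le> 1"
      using l_in l0 d by auto
    then have "(l - l0)\<^sup>2 \<le> 1"
      by (simp add: abs_square_le_1)
    also note W2
    also have "8 / m\<^sup>2 * W2 \<le> C * (W1 + W2)"
      unfolding C_def using W1_nonneg W2_nonneg K_pos \<delta>_pos m_pos by (intro mult_mono) auto
    finally show ?thesis
      unfolding W1_def W2_def .
  qed
qed

end

section \<open>Moments and uniform convergence of the empirical c.d.f.\<close>

text \<open>Pushing forward a uniformly chosen index counts repeated sample values with
  multiplicity.\<close>

definition emp_measure :: "(nat \<Rightarrow> 'a \<Rightarrow> real) \<Rightarrow> nat \<Rightarrow> 'a \<Rightarrow> real measure" where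
  "emp_measure X n \<omega> = distr (measure_pmf (pmf_of_set {1..n})) borel (\<lambda>i. X i \<omega>)"

lemma integral_emp_measure:
  assumes "1 \<le> n" "g \<in> borel_measurable borel"
  shows "(LINT x|emp_measure X n \<omega>. g x) = (\<Sum>i=1..n. g (X i \<omega>)) / real n"
  using assms by (simp add: emp_measure_def integral_distr integral_pmf_of_set)

lemma real_distribution_emp_measure: "real_distribution (emp_measure X n \<omega>)"
  unfolding emp_measure_def by (intro prob_space.real_distribution_distr measure_pmf.prob_space_axioms) simp

lemma cdf_emp_measure:
  assumes "1 \<le> n"
  shows "cdf (emp_measure X n \<omega>) = emp_cdf X n \<omega>"
proof
  fix x
  interpret N: real_distribution "emp_measure X n \<omega>"
    by (rule real_distribution_emp_measure)
  have "cdf (emp_measure X n \<omega>) x = (LINT y|emp_measure X n \<omega>. indicator {..x} y)"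
    by (simp add: cdf_def)
  also have "\<dots> = emp_cdf X n \<omega> x"
    using assms by (subst integral_emp_measure) (auto simp: emp_cdf_def)
  finally show "cdf (emp_measure X n \<omega>) x = emp_cdf X n \<omega> x" .
qed

text \<open>Each of the three coincidences occurs for \<open>n\<close> pairs \<open>(j, k)\<close>;
  pairs with several of them are counted repeatedly.\<close>

lemma card_diagonal_triples:
  fixes i :: nat
  assumes "i \<in> {1..n}"
  shows "(\<Sum>j=1..n. \<Sum>k=1..n. of_bool (j = i) + of_bool (k = i) + of_bool (k = j)) = (3 * real n :: real)"
proof -
  have eq: "(\<Sum>k=1..n. of_bool (k = j)) = (1 :: real)" if "j \<in> {1..n}" for j
    using that by (simp add: of_bool_def)
  have "(\<Sum>j=1..n. \<Sum>k=1..n. of_bool (j = i) + of_bool (k = i) + of_bool (k = j)) =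
      (\<Sum>j=1..n. real n * of_bool (j = i) + 2)"
    using assms by (intro sum.cong) (auto simp: sum.distrib eq)
  also have "\<dots> = 3 * real n"
    using assms by (simp add: sum.distrib eq flip: sum_distrib_left)
  finally show ?thesis .
qed

section \<open>Second moments of the empirical c.d.f. at a sample-dependent point\<close>

context prob_space
begin

lemma emp_cdf_diff_eq:
  assumes "1 \<le> n"
  shows "emp_cdf X n \<omega> x - c = (\<Sum>i=1..n. indicator {..x} (X i \<omega>) - c) / real n"
  using assms by (simp add: emp_cdf_def sum_subtractf field_simps)

lemma expectation_indicator_rv:
  assumes [measurable]: "random_variable borel Y"
  shows "expectation (\<lambda>\<omega>. indicator {..c :: real} (Y \<omega>) - cdf (distr M borel Y) c) = 0"
proof -
  interpret Y: real_distribution "distr M borel Y"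
    by (rule real_distribution_distr) simp
  have "expectation (\<lambda>\<omega>. indicat_real {..c} (Y \<omega>)) = (LINT y|distr M borel Y. indicator {..c} y)"
    using integral_distr[OF assms, of "indicator {..c} :: real \<Rightarrow> real"] by simp
  then have "expectation (\<lambda>\<omega>. indicat_real {..c} (Y \<omega>)) = cdf (distr M borel Y) c"
    by (simp add: cdf_def)
  moreover have "integrable M (\<lambda>\<omega>. indicator {..c} (Y \<omega>) :: real)"
    by (rule integrable_const_bound[of _ 1]) auto
  ultimately show ?thesis
    by (simp add: prob_space)
qed

text \<open>Since \<open>j\<close> differs from \<open>i\<close> and \<open>k\<close>, the law of
  \<open>X j\<close> and the pair \<open>(X i, X k)\<close> is a product. Fubini integrates over
  \<open>X j\<close> first: the threshold is then frozen, and the factor containing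
  \<open>X j\<close> has mean zero.\<close>

lemma expectation_centered_product_eq_0:
  fixes X :: "nat \<Rightarrow> 'a \<Rightarrow> real" and \<phi> G :: "real \<Rightarrow> real"
  assumes indep: "indep_vars (\<lambda>_. borel) X I"
    and cdf: "cdf (distr M borel (X j)) = G"
    and \<phi> [measurable]: "\<phi> \<in> borel_measurable borel"
    and idx: "i \<in> I" "j \<in> I" "k \<in> I" "j \<noteq> i" "j \<noteq> k"
  shows "expectation (\<lambda>\<omega>. (indicator {..\<phi> (X i \<omega>)} (X j \<omega>) - G (\<phi> (X i \<omega>))) *
    (indicator {..\<phi> (X i \<omega>)} (X k \<omega>) - G (\<phi> (X i \<omega>)))) = 0"
proof -
  have rv [measurable]: "random_variable borel (X i)" "random_variable borel (X j)"
      "random_variable borel (X k)"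
    using indep idx by (auto simp: indep_vars_def)
  interpret J: real_distribution "distr M borel (X j)"
    by (rule real_distribution_distr) simp
  have G [measurable]: "G \<in> borel_measurable borel"
    using J.borel_measurable_cdf by (simp add: cdf)
  have G01: "0 \<le> G x" "G x \<le> 1" for x
    using J.cdf_nonneg[of x] J.cdf_bounded_prob[of x] by (auto simp: cdf)
  let ?SP = "Pi\<^sub>M {j} (\<lambda>_. borel :: real measure)" and ?SQ = "Pi\<^sub>M {i, k} (\<lambda>_. borel :: real measure)"
  let ?x = "\<lambda>\<omega>. restrict (\<lambda>i. X i \<omega>) {j}" and ?z = "\<lambda>\<omega>. restrict (\<lambda>i. X i \<omega>) {i, k}"
  let ?P = "distr M ?SP ?x" and ?Q = "distr M ?SQ ?z"
  have "indep_var ?SP ?x ?SQ ?z"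
    using idx by (intro indep_var_restrict[OF indep]) auto
  then have x [measurable]: "?x \<in> measurable M ?SP" and z [measurable]: "?z \<in> measurable M ?SQ"
    and distr: "?P \<Otimes>\<^sub>M ?Q = distr M (?SP \<Otimes>\<^sub>M ?SQ) (\<lambda>\<omega>. (?x \<omega>, ?z \<omega>))"
    by (simp_all add: indep_var_distribution_eq)
  interpret P: prob_space ?P
    by (rule prob_space_distr) fact
  interpret Q: prob_space ?Q
    by (rule prob_space_distr) fact
  interpret PQ: pair_prob_space ?P ?Q ..
  define f :: "real \<Rightarrow> real \<Rightarrow> real" where "f = (\<lambda>y x. indicator {..\<phi> x} y - G (\<phi> x))"
  have f_eq: "f y x = (if y \<le> \<phi> x then 1 else 0) - G (\<phi> x)" for x y
    by (simp add: f_def indicator_def)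
  have f_le: "\<bar>f y x\<bar> \<le> 1" for x y
    unfolding f_eq using G01[of "\<phi> x"] by auto
  have f_meas [measurable]: "case_prod f \<in> borel_measurable (borel \<Otimes>\<^sub>M borel)"
    unfolding f_eq by measurable
  define h where "h = (\<lambda>u v. f (u j) (v i) * f (v k) (v i))"
  have h_meas [measurable]: "case_prod h \<in> borel_measurable (?SP \<Otimes>\<^sub>M ?SQ)"
    unfolding h_def by measurable
  have h_le: "\<bar>h u v\<bar> \<le> 1" for u v
    unfolding h_def abs_mult by (intro mult_le_one f_le) auto
  have int: "integrable (?P \<Otimes>\<^sub>M ?Q) (case_prod h)"
    by (rule PQ.P.integrable_const_bound[of _ 1]) (use h_le in \<open>auto simp: distr\<close>)
  have inner: "(LINT u|?P. h u v) = 0" for v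
  proof -
    have "(LINT u|?P. f (u j) (v i)) = expectation (\<lambda>\<omega>. f (X j \<omega>) (v i))"
      by (subst integral_distr[OF x]) auto
    also have "\<dots> = 0"
      using expectation_indicator_rv[OF rv(2)] by (simp add: cdf f_def)
    finally show ?thesis
      by (simp add: h_def)
  qed
  have "expectation (\<lambda>\<omega>. h (?x \<omega>) (?z \<omega>)) = integral\<^sup>L (?P \<Otimes>\<^sub>M ?Q) (case_prod h)"
    unfolding distr by (subst integral_distr) auto
  also have "\<dots> = (LINT v|?Q. LINT u|?P. h u v)"
    by (rule PQ.integral_snd[OF int, symmetric])
  also have "\<dots> = 0"
    by (simp add: inner)
  finally show ?thesis
    by (simp add: h_def f_def)
qed

text \<open>Conditionally on \<open>X i\<close>, the indicators of \<open>X j \<le> \<phi> (X i)\<close> and \<open>X k \<le> \<phi> (X i)\<close> are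
  uncorrelated, so of the \<open>n\<^sup>2\<close> products only those with coinciding indices contribute.\<close>

lemma emp_cdf_second_moment:
  fixes X :: "nat \<Rightarrow> 'a \<Rightarrow> real" and \<phi> G :: "real \<Rightarrow> real"
  assumes indep: "indep_vars (\<lambda>_. borel) X {1..n}"
    and cdf: "\<And>j. j \<in> {1..n} \<Longrightarrow> cdf (distr M borel (X j)) = G"
    and \<phi> [measurable]: "\<phi> \<in> borel_measurable borel"
    and i: "i \<in> {1..n}"
  shows "expectation (\<lambda>\<omega>. (emp_cdf X n \<omega> (\<phi> (X i \<omega>)) - G (\<phi> (X i \<omega>)))\<^sup>2) \<le> 3 / real n"
proof -
  have n: "1 \<le> n"
    using i by simp
  have rv [measurable]: "random_variable borel (X j)" if "j \<in> {1..n}" for j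
    using indep that by (auto simp: indep_vars_def)
  interpret I: real_distribution "distr M borel (X i)"
    by (rule real_distribution_distr) (use i in simp)
  have G [measurable]: "G \<in> borel_measurable borel"
    using I.borel_measurable_cdf by (simp add: cdf[OF i])
  have G01: "0 \<le> G x" "G x \<le> 1" for x
    using I.cdf_nonneg[of x] I.cdf_bounded_prob[of x] by (auto simp: cdf[OF i])
  define f :: "nat \<Rightarrow> 'a \<Rightarrow> real" where "f = (\<lambda>j \<omega>. indicator {..\<phi> (X i \<omega>)} (X j \<omega>) - G (\<phi> (X i \<omega>)))"
  have f_eq: "f j \<omega> = (if X j \<omega> \<le> \<phi> (X i \<omega>) then 1 else 0) - G (\<phi> (X i \<omega>))" for j \<omega>
    by (simp add: f_def indicator_def)
  have f_meas [measurable]: "f j \<in> borel_measurable M" if "j \<in> {1..n}" for j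
    using rv[OF i] rv[OF that] unfolding f_eq by measurable
  have f_le: "\<bar>f j \<omega> * f k \<omega>\<bar> \<le> 1" for j k \<omega>
    unfolding abs_mult by (intro mult_le_one) (use G01[of "\<phi> (X i \<omega>)"] in \<open>auto simp: f_eq\<close>)
  have int: "integrable M (\<lambda>\<omega>. f j \<omega> * f k \<omega>)" if "j \<in> {1..n}" "k \<in> {1..n}" for j k
    by (rule integrable_const_bound[of _ 1]) (use f_le that in auto)
  \<comment> \<open>Three distinct indices give mean zero; otherwise the product is at most 1 and at
    least one coincidence is counted.\<close>
  have prod_le: "expectation (\<lambda>\<omega>. f j \<omega> * f k \<omega>) \<le> of_bool (j = i) + of_bool (k = i) + of_bool (k = j)"
    if jk: "j \<in> {1..n}" "k \<in> {1..n}" for j k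
  proof (cases "j \<noteq> i \<and> k \<noteq> i \<and> k \<noteq> j")
    case True
    then show ?thesis
      using expectation_centered_product_eq_0[OF indep cdf[OF jk(1)] \<phi> i jk]
      by (auto simp: f_def)
  next
    case False
    have "expectation (\<lambda>\<omega>. f j \<omega> * f k \<omega>) \<le> expectation (\<lambda>\<omega>. 1)"
      using f_le[THEN abs_le_D1] by (intro integral_mono int jk) auto
    then show ?thesis
      using False by (auto simp: prob_space)
  qed
  have "(emp_cdf X n \<omega> (\<phi> (X i \<omega>)) - G (\<phi> (X i \<omega>)))\<^sup>2 = (\<Sum>j=1..n. \<Sum>k=1..n. f j \<omega> * f k \<omega>) / (real n)\<^sup>2" for \<omega>
    unfolding emp_cdf_diff_eq[OF n] f_def[symmetric] power_divide
    by (simp add: power2_eq_square sum_product f_def)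
  moreover have "expectation (\<lambda>\<omega>. \<Sum>j=1..n. \<Sum>k=1..n. f j \<omega> * f k \<omega>) =
      (\<Sum>j=1..n. \<Sum>k=1..n. expectation (\<lambda>\<omega>. f j \<omega> * f k \<omega>))"
    by (subst Bochner_Integration.integral_sum)
      (auto intro!: sum.cong Bochner_Integration.integral_sum Bochner_Integration.integrable_sum int)
  ultimately have "expectation (\<lambda>\<omega>. (emp_cdf X n \<omega> (\<phi> (X i \<omega>)) - G (\<phi> (X i \<omega>)))\<^sup>2) =
      (\<Sum>j=1..n. \<Sum>k=1..n. expectation (\<lambda>\<omega>. f j \<omega> * f k \<omega>)) / (real n)\<^sup>2"
    by simp
  also have "\<dots> \<le> (\<Sum>j=1..n. \<Sum>k=1..n. of_bool (j = i) + of_bool (k = i) + of_bool (k = j)) / (real n)\<^sup>2"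
    by (intro divide_right_mono sum_mono prod_le) auto
  also have "\<dots> = 3 / real n"
    unfolding card_diagonal_triples[OF i] using n by (simp add: power2_eq_square)
  finally show ?thesis .
qed

end

text \<open>Monotonicity squeezes \<open>F\<close> between neighbouring grid points, across which
  \<open>G\<close> grows by at most \<open>\<epsilon>\<close>; beyond \<open>a\<close> and
  \<open>b\<close> the tails of \<open>G\<close> are below \<open>\<epsilon>\<close>. The grid is
  fixed before \<open>F\<close>, so it serves all sample sizes and outcomes.\<close>

lemma uniform_cdf_grid:
  fixes G :: "real \<Rightarrow> real"
  assumes G_mono: "mono G" and lip: "\<And>x y. \<bar>G x - G y\<bar> \<le> L * \<bar>x - y\<bar>" and L: "0 < L"
    and G01: "\<And>x. 0 \<le> G x" "\<And>x. G x \<le> 1"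
    and lim: "(G \<longlongrightarrow> 0) at_bot" "(G \<longlongrightarrow> 1) at_top" and \<epsilon>: "0 < \<epsilon>"
  obtains S where "finite S"
    "\<And>F x. mono F \<Longrightarrow> (\<And>x. 0 \<le> F x) \<Longrightarrow> (\<And>x. F x \<le> 1) \<Longrightarrow> (\<And>s. s \<in> S \<Longrightarrow> \<bar>F s - G s\<bar> \<le> \<epsilon>) \<Longrightarrow>
      \<bar>F x - G x\<bar> \<le> 2 * \<epsilon>"
proof -
  obtain a where a: "G a \<le> \<epsilon>"
    using order_tendstoD(2)[OF lim(1) \<epsilon>] by (auto simp: eventually_at_bot_linorder intro: less_imp_le)
  obtain b where b: "1 - \<epsilon> \<le> G b"
    using order_tendstoD(1)[OF lim(2), of "1 - \<epsilon>"] \<epsilon>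
    by (auto simp: eventually_at_top_linorder intro: less_imp_le)
  define h where "h = \<epsilon> / L"
  have h: "0 < h"
    using \<epsilon> L by (simp add: h_def)
  \<comment> \<open>The mesh is \<open>\<epsilon> / L\<close> by the Lipschitz bound. The
    \<open>Suc\<close> provides a right neighbour for the last cell, and \<open>b\<close> is added
    because it need not lie on the grid.\<close>
  define S where "S = insert b ((\<lambda>j. a + real j * h) ` {..Suc (nat \<lfloor>(b - a) / h\<rfloor>)})"
  show ?thesis
  proof (rule that)
    show "finite S"
      by (simp add: S_def)
    fix F :: "real \<Rightarrow> real" and x
    assume F: "mono F" "\<And>x. 0 \<le> F x" "\<And>x. F x \<le> 1" and S: "\<And>s. s \<in> S \<Longrightarrow> \<bar>F s - G s\<bar> \<le> \<epsilon>"
    have grid: "\<bar>F (a + real j * h) - G (a + real j * h)\<bar> \<le> \<epsilon>" if "j \<le> Suc (nat \<lfloor>(b - a) / h\<rfloor>)" for j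
      using that by (intro S) (auto simp: S_def)
    consider "x \<le> a" | "b \<le> x" | "a \<le> x" "x \<le> b"
      by linarith
    then show "\<bar>F x - G x\<bar> \<le> 2 * \<epsilon>"
    proof cases
      case 1
      then have "F x \<le> F a" "G x \<le> G a"
        using F(1) G_mono by (auto simp: mono_def)
      moreover have "\<bar>F a - G a\<bar> \<le> \<epsilon>"
        using grid[of 0] by simp
      ultimately show ?thesis
        using F(2)[of x] G01(1)[of x] a by linarith
    next
      case 2
      then have "F b \<le> F x" "G b \<le> G x"
        using F(1) G_mono by (auto simp: mono_def)
      moreover have "\<bar>F b - G b\<bar> \<le> \<epsilon>"
        by (intro S) (simp add: S_def)
      ultimately show ?thesis
        using F(3)[of x] G01(2)[of x] b by linarith
    next
      case 3
      define j where "j = nat \<lfloor>(x - a) / h\<rfloor>"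
      have "real j = of_int \<lfloor>(x - a) / h\<rfloor>"
        using 3 h by (simp add: j_def)
      then have "real j \<le> (x - a) / h" "(x - a) / h \<le> real j + 1"
        by linarith+
      then have j: "a + real j * h \<le> x" "x \<le> a + real (Suc j) * h"
        using h by (simp_all add: field_simps)
      have "(x - a) / h \<le> (b - a) / h"
        using 3 h by (intro divide_right_mono) auto
      then have j_le: "j \<le> nat \<lfloor>(b - a) / h\<rfloor>"
        unfolding j_def by (intro nat_mono floor_mono)
      have "\<bar>G (a + real (Suc j) * h) - G (a + real j * h)\<bar> \<le> \<epsilon>"
      proof -
        have "a + real (Suc j) * h - (a + real j * h) = h"
          by (simp add: algebra_simps)
        then have "\<bar>G (a + real (Suc j) * h) - G (a + real j * h)\<bar> \<le> L * \<bar>h\<bar>"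
          using lip[of "a + real (Suc j) * h" "a + real j * h"] by simp
        then show ?thesis
          using \<epsilon> L by (simp add: h_def)
      qed
      moreover have "G (a + real j * h) \<le> G x" "G x \<le> G (a + real (Suc j) * h)"
        "F (a + real j * h) \<le> F x" "F x \<le> F (a + real (Suc j) * h)"
        using j F(1) G_mono unfolding mono_def by blast+
      ultimately show ?thesis
        using grid[of j] grid[of "Suc j"] j_le by linarith
    qed
  qed
qed

lemma mono_emp_cdf: "mono (emp_cdf X n \<omega>)"
  unfolding emp_cdf_def
  by (intro monoI mult_left_mono sum_mono) (auto simp: indicator_def)

lemma emp_cdf_nonneg: "0 \<le> emp_cdf X n \<omega> x"
  unfolding emp_cdf_def by (intro mult_nonneg_nonneg sum_nonneg) auto

lemma emp_cdf_le_1: "emp_cdf X n \<omega> x \<le> 1"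
proof -
  have "(\<Sum>i=1..n. indicator {..x} (X i \<omega>)) \<le> (\<Sum>i=1..n. (1::real))"
    by (intro sum_mono) (auto simp: indicator_def)
  then show ?thesis
    by (cases "n = 0") (auto simp: emp_cdf_def divide_simps)
qed

section \<open>Pointwise almost sure convergence\<close>

context prob_space
begin

text \<open>Hoeffding's inequality for indicators makes the probabilities of an
  \<open>\<epsilon>\<close>-deviation decay geometrically in \<open>n\<close>, so Borel-Cantelli
  applies.\<close>

lemma AE_emp_cdf_tendsto:
  fixes X :: "nat \<Rightarrow> 'a \<Rightarrow> real"
  assumes indep: "indep_vars (\<lambda>_. borel) X {1..}"
    and cdf: "\<And>j. 1 \<le> j \<Longrightarrow> cdf (distr M borel (X j)) = G"
  shows "AE \<omega> in M. (\<lambda>n. emp_cdf X n \<omega> c) \<longlonglongrightarrow> G c"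
proof -
  have rv [measurable]: "random_variable borel (X j)" if "1 \<le> j" for j
    using indep that by (auto simp: indep_vars_def)
  have ev: "AE \<omega> in M. \<forall>\<^sub>F n in sequentially. \<bar>emp_cdf X n \<omega> c - G c\<bar> < \<epsilon>" if \<epsilon>: "0 < \<epsilon>" for \<epsilon>
  proof -
    define A where "A n = {\<omega> \<in> space M. \<epsilon> \<le> \<bar>emp_cdf X n \<omega> c - G c\<bar>}" for n
    have "(\<lambda>\<omega>. \<Sum>i=1..n. indicat_real {..c} (X i \<omega>)) \<in> borel_measurable M" for n
      by (intro borel_measurable_sum measurable_compose[OF rv]) auto
    then have [measurable]: "(\<lambda>\<omega>. emp_cdf X n \<omega> c) \<in> borel_measurable M" for n
      unfolding emp_cdf_def by measurable
    have A_sets: "A n \<in> sets M" for n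
      unfolding A_def by measurable
    have A_prob: "prob (A n) \<le> 2 * exp (- 2 * \<epsilon>\<^sup>2) ^ n" if n: "1 \<le> n" for n
    proof -
      have ex: "expectation (\<lambda>\<omega>. indicat_real {..c} (X i \<omega>)) = G c" if "i \<in> {1..n}" for i
      proof -
        have "integrable M (\<lambda>\<omega>. indicat_real {..c} (X i \<omega>))"
          using rv[of i] that by (intro integrable_const_bound[of _ 1]) auto
        then show ?thesis
          using expectation_indicator_rv[OF rv[of i], of c] cdf[of i] that by (simp add: prob_space)
      qed
      interpret H: Hoeffding_ineq M "{1..n}" "\<lambda>i \<omega>. indicat_real {..c} (X i \<omega>)" "\<lambda>_. 0" "\<lambda>_. 1" "real n * G c"
      proof unfold_locales
        show "indep_vars (\<lambda>_. borel) (\<lambda>i \<omega>. indicat_real {..c} (X i \<omega>)) {1..n}"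
          by (rule indep_vars_compose2[OF indep_vars_subset[OF indep]]) auto
        show "real n * G c \<equiv> \<Sum>i=1..n. expectation (\<lambda>\<omega>. indicat_real {..c} (X i \<omega>))"
          using ex by simp
      qed (auto simp: indicator_def)
      have "A n = {\<omega> \<in> space M. \<epsilon> * real n \<le> \<bar>(\<Sum>i=1..n. indicat_real {..c} (X i \<omega>)) - real n * G c\<bar>}"
      proof -
        have "emp_cdf X n \<omega> c - G c = ((\<Sum>i=1..n. indicat_real {..c} (X i \<omega>)) - real n * G c) / real n" for \<omega>
          using n by (simp add: emp_cdf_def diff_divide_distrib)
        then show ?thesis
          using n by (simp add: A_def pos_le_divide_eq)
      qed
      also have "prob \<dots> \<le> 2 * exp (- 2 * (\<epsilon> * real n)\<^sup>2 / (\<Sum>i=1..n. (1 - 0)\<^sup>2))"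
        using \<epsilon> n by (intro H.Hoeffding_ineq_abs_ge) auto
      also have "\<dots> = 2 * exp (real n * (- 2 * \<epsilon>\<^sup>2))"
        using n by (simp add: power2_eq_square field_simps)
      finally show ?thesis
        by (simp only: exp_of_nat_mult)
    qed
    have "summable (\<lambda>n. prob (A n))"
    proof (rule summable_comparison_test'[where N = 1])
      show "summable (\<lambda>n. 2 * exp (- 2 * \<epsilon>\<^sup>2) ^ n)"
        using \<epsilon> by (intro summable_mult summable_geometric) simp
      show "norm (prob (A n)) \<le> 2 * exp (- 2 * \<epsilon>\<^sup>2) ^ n" if "1 \<le> n" for n
        using A_prob[OF that] by simp
    qed
    then have "AE \<omega> in M. \<forall>\<^sub>F n in sequentially. \<omega> \<in> space M - A n"
      by (intro borel_cantelli_AE1 A_sets) (auto simp: less_top[symmetric])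
    then show ?thesis
      by eventually_elim (auto simp: A_def not_le elim: eventually_mono)
  qed
  \<comment> \<open>Countably many precisions allow a single null set.\<close>
  have "AE \<omega> in M. \<forall>m. \<forall>\<^sub>F n in sequentially. \<bar>emp_cdf X n \<omega> c - G c\<bar> < inverse (real (Suc m))"
    by (subst AE_all_countable) (intro allI ev, simp)
  then show ?thesis
  proof eventually_elim
    case (elim \<omega>)
    show ?case
    proof (rule tendstoI)
      fix \<epsilon> :: real
      assume "0 < \<epsilon>"
      then obtain m where "inverse (real (Suc m)) < \<epsilon>"
        using reals_Archimedean by blast
      with elim[rule_format, of m] show "\<forall>\<^sub>F n in sequentially. dist (emp_cdf X n \<omega> c) (G c) < \<epsilon>"
        by (auto simp: dist_real_def elim: eventually_mono)
    qed
  qed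
qed

end

section \<open>Asymptotics of the estimator\<close>

locale mixture_sample = symmetric_mixture + prob_space M
  for M :: "'a measure" +
  fixes X :: "nat \<Rightarrow> 'a \<Rightarrow> real"
  assumes indep: "indep_vars (\<lambda>_. borel) X {1..}"
    and cdf_X: "1 \<le> i \<Longrightarrow> cdf (distr M borel (X i)) = G"
begin

lemma rv_X: "1 \<le> i \<Longrightarrow> random_variable borel (X i)"
  using indep by (auto simp: indep_vars_def)

text \<open>The finite grids for the precisions \<open>inverse (real (Suc m))\<close> involve
  countably many points in all, so one null set serves them all, and convergence on each finite grid
  is uniform.\<close>

lemma glivenko_cantelli:
  "AE \<omega> in M. \<forall>\<epsilon>>0. \<forall>\<^sub>F n in sequentially. \<forall>x. \<bar>emp_cdf X n \<omega> x - G x\<bar> \<le> \<epsilon>"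
proof -
  interpret X1: real_distribution "distr M borel (X 1)"
    by (rule real_distribution_distr) (simp add: rv_X)
  have G: "mono G" "(G \<longlongrightarrow> 0) at_bot" "(G \<longlongrightarrow> 1) at_top" "0 \<le> G x" "G x \<le> 1" for x
    using X1.cdf_nondecreasing X1.cdf_lim_at_bot X1.cdf_lim_at_top_prob X1.cdf_nonneg X1.cdf_bounded_prob
    by (auto simp: cdf_X mono_def)
  have "\<exists>S. finite S \<and> (\<forall>F x. mono F \<longrightarrow> (\<forall>x. 0 \<le> F x) \<longrightarrow> (\<forall>x. F x \<le> 1) \<longrightarrow>
      (\<forall>s\<in>S. \<bar>F s - G s\<bar> \<le> inverse (real (Suc m))) \<longrightarrow> \<bar>F x - G x\<bar> \<le> 2 * inverse (real (Suc m)))" for m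
  proof -
    have "0 < inverse (real (Suc m))"
      by simp
    then obtain S where "finite S" "\<And>F x. mono F \<Longrightarrow> (\<And>x. 0 \<le> F x) \<Longrightarrow> (\<And>x. F x \<le> 1) \<Longrightarrow>
        (\<And>s. s \<in> S \<Longrightarrow> \<bar>F s - G s\<bar> \<le> inverse (real (Suc m))) \<Longrightarrow> \<bar>F x - G x\<bar> \<le> 2 * inverse (real (Suc m))"
      using uniform_cdf_grid[OF G(1) G_lip L_pos G(4,5,2,3)] by metis
    then show ?thesis
      by (intro exI[of _ S] conjI allI impI) simp_all
  qed
  then obtain S where S: "\<And>m. finite (S m)"
    "\<And>m F x. mono F \<Longrightarrow> (\<And>x. 0 \<le> F x) \<Longrightarrow> (\<And>x. F x \<le> 1) \<Longrightarrow>
      (\<And>s. s \<in> S m \<Longrightarrow> \<bar>F s - G s\<bar> \<le> inverse (real (Suc m))) \<Longrightarrow> \<bar>F x - G x\<bar> \<le> 2 * inverse (real (Suc m))"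
    by metis
  have "AE \<omega> in M. \<forall>m. \<forall>s\<in>S m. (\<lambda>n. emp_cdf X n \<omega> s) \<longlonglongrightarrow> G s"
    by (subst AE_all_countable) (intro allI AE_finite_allI S AE_emp_cdf_tendsto indep cdf_X)
  then show ?thesis
  proof eventually_elim
    case (elim \<omega>)
    show ?case
    proof (intro allI impI)
      fix \<epsilon> :: real
      assume "0 < \<epsilon>"
      then obtain m where m: "inverse (real (Suc m)) < \<epsilon> / 2"
        using reals_Archimedean[of "\<epsilon> / 2"] by auto
      have "\<forall>\<^sub>F n in sequentially. \<forall>s\<in>S m. dist (emp_cdf X n \<omega> s) (G s) < inverse (real (Suc m))"
        using elim S(1) by (intro eventually_ball_finite ballI tendstoD) auto
      then show "\<forall>\<^sub>F n in sequentially. \<forall>x. \<bar>emp_cdf X n \<omega> x - G x\<bar> \<le> \<epsilon>"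
      proof eventually_elim
        case (elim n)
        show ?case
        proof
          fix x
          have "\<bar>emp_cdf X n \<omega> x - G x\<bar> \<le> 2 * inverse (real (Suc m))"
            using elim by (intro S(2) mono_emp_cdf emp_cdf_nonneg emp_cdf_le_1)
              (auto simp: dist_real_def intro: less_imp_le)
          with m show "\<bar>emp_cdf X n \<omega> x - G x\<bar> \<le> \<epsilon>"
            by linarith
        qed
      qed
    qed
  qed
qed

section \<open>The dominating quantity and its moments\<close>

definition D :: "nat \<Rightarrow> 'a \<Rightarrow> real \<Rightarrow> real" where
  "D n \<omega> x = emp_cdf X n \<omega> x - G x"

text \<open>The bracket in \<open>arg_min_contrast_bound\<close> for the empirical law; the
  estimator does not occur in it.\<close>

definition W :: "nat \<Rightarrow> 'a \<Rightarrow> real" where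
  "W n \<omega> = (\<Sum>i=1..n. dev (D n \<omega>) (X i \<omega>)) / real n + (\<Sum>s\<in>test_points. (D n \<omega> s)\<^sup>2)"

lemma abs_D_le: "\<bar>D n \<omega> x\<bar> \<le> 2"
  using emp_cdf_nonneg[of X n \<omega> x] emp_cdf_le_1[of X n \<omega> x] abs_G_le[of x] unfolding D_def by linarith

text \<open>Endpoints of the two windows may coincide, hence an inequality.\<close>

lemma card_test_points: "card test_points \<le> 4"
  unfolding test_points_def by (intro order_trans[OF card_insert_le_m1]) (auto simp: card_insert_if)

lemma emp_cdf_borel: "emp_cdf X n \<omega> \<in> borel_measurable borel"
  by (rule borel_measurable_mono[OF mono_emp_cdf])

lemma estimator_bound:
  assumes n: "1 \<le> n"
    and l: "is_arg_min (\<lambda>l. contrast \<mu>1 \<mu>2 l (emp_cdf X n \<omega>)) (\<lambda>l. l \<in> {0..1/2 - d}) l"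
  shows "(l - l0)\<^sup>2 \<le> C * W n \<omega>"
proof -
  have D_eq: "D n \<omega> = (\<lambda>x. emp_cdf X n \<omega> x - G x)"
    by (simp add: D_def fun_eq_iff)
  have [measurable]: "D n \<omega> \<in> borel_measurable borel"
    unfolding D_def using emp_cdf_borel by measurable
  have "(l - l0)\<^sup>2 \<le> C * ((LINT x|emp_measure X n \<omega>. dev (D n \<omega>) x) + (\<Sum>s\<in>test_points. (D n \<omega> s)\<^sup>2))"
    using arg_min_contrast_bound[OF real_distribution_emp_measure, of X n \<omega> l] l
    unfolding D_eq cdf_emp_measure[OF n] by simp
  also have "(LINT x|emp_measure X n \<omega>. dev (D n \<omega>) x) = (\<Sum>i=1..n. dev (D n \<omega>) (X i \<omega>)) / real n"
    by (intro integral_emp_measure n borel_measurable_dev) simp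
  finally show ?thesis
    by (simp add: W_def)
qed

text \<open>The constant 5 is 1 from the first term of \<open>dev\<close> plus 4 for the test
  points.\<close>

lemma W_le:
  assumes "1 \<le> n" and t: "\<And>x. \<bar>D n \<omega> x\<bar> \<le> t"
  shows "W n \<omega> \<le> (5 + 1 / (1 - q)) * t\<^sup>2"
proof -
  have "(\<Sum>i=1..n. dev (D n \<omega>) (X i \<omega>)) \<le> real n * ((1 + 1 / (1 - q)) * t\<^sup>2)"
    using sum_bounded_above[of "{1..n}", OF dev_le[where D = "D n \<omega>", OF t]] by simp
  then have "(\<Sum>i=1..n. dev (D n \<omega>) (X i \<omega>)) / real n \<le> (1 + 1 / (1 - q)) * t\<^sup>2"
    using assms(1) by (simp add: field_simps)
  moreover have "(\<Sum>s\<in>test_points. (D n \<omega> s)\<^sup>2) \<le> 4 * t\<^sup>2"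
  proof -
    have "(D n \<omega> s)\<^sup>2 \<le> t\<^sup>2" for s
      using t[of s] by (metis abs_ge_zero power2_abs power_mono)
    then have "(\<Sum>s\<in>test_points. (D n \<omega> s)\<^sup>2) \<le> real (card test_points) * t\<^sup>2"
      by (intro sum_bounded_above)
    also have "\<dots> \<le> 4 * t\<^sup>2"
      using card_test_points by (intro mult_right_mono) auto
    finally show ?thesis .
  qed
  ultimately show ?thesis
    unfolding W_def by (simp add: algebra_simps)
qed

lemma measurable_D:
  assumes [measurable]: "\<phi> \<in> borel_measurable M"
  shows "(\<lambda>\<omega>. D n \<omega> (\<phi> \<omega>)) \<in> borel_measurable M"
proof -
  have [measurable]: "(\<lambda>\<omega>. \<Sum>i=1..n. if X i \<omega> \<le> \<phi> \<omega> then 1 else (0::real)) \<in> borel_measurable M"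
  proof (rule borel_measurable_sum)
    fix i
    assume "i \<in> {1..n}"
    then have [measurable]: "X i \<in> borel_measurable M"
      by (simp add: rv_X)
    show "(\<lambda>\<omega>. if X i \<omega> \<le> \<phi> \<omega> then 1 else (0::real)) \<in> borel_measurable M"
      by measurable
  qed
  \<comment> \<open>The threshold is random, so the indicator is rewritten as a comparison of two
    random variables.\<close>
  have eq: "(\<lambda>\<omega>. D n \<omega> (\<phi> \<omega>)) =
      (\<lambda>\<omega>. (1 / real n) * (\<Sum>i=1..n. if X i \<omega> \<le> \<phi> \<omega> then 1 else 0) - G (\<phi> \<omega>))"
    by (simp only: D_def emp_cdf_def indicator_def of_bool_def atMost_iff)
  show ?thesis
    unfolding eq by measurable
qed

text \<open>Three choices of \<open>\<phi>\<close> are used: the identity and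
  \<open>\<lambda>x. e k - x\<close> for the two parts of \<open>dev\<close>, and constants for the
  test points.\<close>

lemma D_second_moment:
  assumes "i \<in> {1..n}" "\<phi> \<in> borel_measurable borel"
  shows "integrable M (\<lambda>\<omega>. (D n \<omega> (\<phi> (X i \<omega>)))\<^sup>2)"
    and "expectation (\<lambda>\<omega>. (D n \<omega> (\<phi> (X i \<omega>)))\<^sup>2) \<le> 3 / real n"
proof -
  have [measurable]: "(\<lambda>\<omega>. D n \<omega> (\<phi> (X i \<omega>))) \<in> borel_measurable M"
    using assms rv_X[of i] by (intro measurable_D) simp
  have "(D n \<omega> x)\<^sup>2 \<le> 2\<^sup>2" for \<omega> x
    using abs_D_le[of n \<omega> x] by (metis abs_ge_zero power2_abs power_mono)
  then show "integrable M (\<lambda>\<omega>. (D n \<omega> (\<phi> (X i \<omega>)))\<^sup>2)"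
    by (intro integrable_const_bound[of _ "2\<^sup>2"]) auto
  show "expectation (\<lambda>\<omega>. (D n \<omega> (\<phi> (X i \<omega>)))\<^sup>2) \<le> 3 / real n"
    unfolding D_def using assms
    by (intro emp_cdf_second_moment indep_vars_subset[OF indep] cdf_X) auto
qed

text \<open>The weights \<open>q ^ k\<close> are summable and the second moments uniformly bounded,
  which justifies integrating the series term by term.\<close>

lemma dev_expectation:
  assumes i: "i \<in> {1..n}"
  shows "integrable M (\<lambda>\<omega>. dev (D n \<omega>) (X i \<omega>))"
    and "expectation (\<lambda>\<omega>. dev (D n \<omega>) (X i \<omega>)) \<le> (1 + 1 / (1 - q)) * (3 / real n)"
proof -
  let ?f = "\<lambda>k \<omega>. q ^ k * (D n \<omega> (e k - X i \<omega>))\<^sup>2"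
  have I: "integrable M (\<lambda>\<omega>. (D n \<omega> (e k - X i \<omega>))\<^sup>2)"
    and E: "expectation (\<lambda>\<omega>. (D n \<omega> (e k - X i \<omega>))\<^sup>2) \<le> 3 / real n" for k
    using D_second_moment[OF i, of "\<lambda>x. e k - x"] by auto
  have f_int: "integrable M (?f k)" for k
    using I by simp
  have f_le: "\<bar>expectation (?f k)\<bar> \<le> q ^ k * (3 / real n)" for k
    using mult_left_mono[OF E[of k], of "q ^ k"] q by (simp add: abs_mult)
  have norm_f: "norm (?f k \<omega>) = ?f k \<omega>" for k \<omega>
    using q by simp
  have AE_s: "AE \<omega> in M. summable (\<lambda>k. norm (?f k \<omega>))"
    unfolding norm_f using dev_series(1)[where D = "D n _", OF abs_D_le] by simp
  have s: "summable (\<lambda>k. expectation (\<lambda>\<omega>. norm (?f k \<omega>)))"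
    unfolding norm_f by (rule abs_suminf_le_geometric(1)[OF f_le]) (use q in auto)
  have I2: "integrable M (\<lambda>\<omega>. \<Sum>k. ?f k \<omega>)"
    by (rule integrable_suminf[OF f_int AE_s s])
  have "expectation (\<lambda>\<omega>. \<Sum>k. ?f k \<omega>) = (\<Sum>k. expectation (?f k))"
    by (rule integral_suminf[OF f_int AE_s s])
  also have "\<dots> \<le> 3 / real n / (1 - q)"
    using abs_suminf_le_geometric(2)[OF f_le] q by auto
  finally have E2: "expectation (\<lambda>\<omega>. \<Sum>k. ?f k \<omega>) \<le> 3 / real n / (1 - q)" .
  have I1: "integrable M (\<lambda>\<omega>. (D n \<omega> (X i \<omega>))\<^sup>2)" and E1: "expectation (\<lambda>\<omega>. (D n \<omega> (X i \<omega>))\<^sup>2) \<le> 3 / real n"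
    using D_second_moment[OF i, of "\<lambda>x. x"] by auto
  show "integrable M (\<lambda>\<omega>. dev (D n \<omega>) (X i \<omega>))"
    unfolding dev_def using I1 I2 by simp
  show "expectation (\<lambda>\<omega>. dev (D n \<omega>) (X i \<omega>)) \<le> (1 + 1 / (1 - q)) * (3 / real n)"
    unfolding dev_def using I1 I2 E1 E2 by (simp add: algebra_simps)
qed

lemma W_expectation:
  assumes n: "1 \<le> n"
  shows "integrable M (W n)" and "expectation (W n) \<le> (5 + 1 / (1 - q)) * (3 / real n)"
proof -
  have S: "integrable M (\<lambda>\<omega>. (D n \<omega> s)\<^sup>2)" "expectation (\<lambda>\<omega>. (D n \<omega> s)\<^sup>2) \<le> 3 / real n" for s
    using D_second_moment[of 1 n "\<lambda>_. s"] n by auto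
  have I1: "integrable M (\<lambda>\<omega>. (\<Sum>i=1..n. dev (D n \<omega>) (X i \<omega>)) / real n)"
    by (intro Bochner_Integration.integrable_divide Bochner_Integration.integrable_sum dev_expectation(1))
  have I2: "integrable M (\<lambda>\<omega>. \<Sum>s\<in>test_points. (D n \<omega> s)\<^sup>2)"
    by (intro Bochner_Integration.integrable_sum S)
  show "integrable M (W n)"
    unfolding W_def using I1 I2 by simp
  have "expectation (\<lambda>\<omega>. (\<Sum>i=1..n. dev (D n \<omega>) (X i \<omega>)) / real n) =
      (\<Sum>i=1..n. expectation (\<lambda>\<omega>. dev (D n \<omega>) (X i \<omega>))) / real n"
    by (subst Bochner_Integration.integral_divide_zero, subst Bochner_Integration.integral_sum)
      (auto intro: dev_expectation(1))
  also have "\<dots> \<le> (real n * ((1 + 1 / (1 - q)) * (3 / real n))) / real n"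
  proof (rule divide_right_mono)
    show "(\<Sum>i=1..n. expectation (\<lambda>\<omega>. dev (D n \<omega>) (X i \<omega>))) \<le>
        real n * ((1 + 1 / (1 - q)) * (3 / real n))"
      by (rule order_trans[OF sum_bounded_above[OF dev_expectation(2)]]) auto
  qed simp
  finally have E1: "expectation (\<lambda>\<omega>. (\<Sum>i=1..n. dev (D n \<omega>) (X i \<omega>)) / real n) \<le> (1 + 1 / (1 - q)) * (3 / real n)"
    using n by simp
  have "expectation (\<lambda>\<omega>. \<Sum>s\<in>test_points. (D n \<omega> s)\<^sup>2) = (\<Sum>s\<in>test_points. expectation (\<lambda>\<omega>. (D n \<omega> s)\<^sup>2))"
    by (intro Bochner_Integration.integral_sum S)
  also have "\<dots> \<le> real (card test_points) * (3 / real n)"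
    by (intro sum_bounded_above S)
  also have "\<dots> \<le> 4 * (3 / real n)"
    using card_test_points by (intro mult_right_mono) auto
  finally have E2: "expectation (\<lambda>\<omega>. \<Sum>s\<in>test_points. (D n \<omega> s)\<^sup>2) \<le> 4 * (3 / real n)" .
  show "expectation (W n) \<le> (5 + 1 / (1 - q)) * (3 / real n)"
    unfolding W_def using I1 I2 E1 E2 by (simp add: algebra_simps)
qed

end

section \<open>Tightness and conclusion\<close>

lemma tight_if_bounded_second_moment:
  fixes Y :: "nat \<Rightarrow> 'a \<Rightarrow> real"
  assumes "prob_space M" and Y: "\<And>n. Y n \<in> borel_measurable M"
    and int: "\<And>n. integrable M (\<lambda>\<omega>. (Y n \<omega>)\<^sup>2)" and le: "\<And>n. (LINT \<omega>|M. (Y n \<omega>)\<^sup>2) \<le> B"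
  shows "tight (\<lambda>n. distr M borel (Y n))"
  unfolding tight_def
proof (intro conjI allI impI)
  interpret prob_space M by fact
  show "real_distribution (distr M borel (Y n))" for n
    using Y by simp
  fix \<epsilon> :: real
  assume \<epsilon>: "0 < \<epsilon>"
  have B: "0 \<le> B"
  proof -
    have "0 \<le> (LINT \<omega>|M. (Y 0 \<omega>)\<^sup>2)"
      by (rule integral_nonneg_AE) simp
    with le[of 0] show ?thesis
      by linarith
  qed
  \<comment> \<open>The added 1 keeps \<open>t\<close> positive when \<open>B = 0\<close> and makes
    the Markov bound \<open>B / t\<^sup>2\<close> strictly smaller than
    \<open>\<epsilon>\<close>.\<close>
  define t where "t = sqrt ((B + 1) / \<epsilon>)"
  have t: "0 < t" "t\<^sup>2 = (B + 1) / \<epsilon>"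
    using B \<epsilon> by (auto simp: t_def)
  have "1 - \<epsilon> < measure (distr M borel (Y n)) {- t<..t}" for n
  proof -
    note [measurable] = Y[of n]
    let ?A = "{\<omega> \<in> space M. t\<^sup>2 \<le> (Y n \<omega>)\<^sup>2}"
    have "prob ?A \<le> (LINT \<omega>|M. (Y n \<omega>)\<^sup>2) / t\<^sup>2"
      using t(1) by (intro integral_Markov_inequality_measure[where A = "{}"] int) auto
    also have "\<dots> \<le> B / t\<^sup>2"
      using le[of n] by (intro divide_right_mono) auto
    also have "\<dots> < \<epsilon>"
      using B \<epsilon> by (simp add: t(2) field_simps)
    finally have "1 - \<epsilon> < 1 - prob ?A"
      by simp
    also have "\<dots> = prob (space M - ?A)"
      by (rule prob_compl[symmetric]) measurable
    also have "\<dots> \<le> prob (Y n -` {- t<..t} \<inter> space M)"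
    proof (rule finite_measure_mono)
      show "space M - ?A \<subseteq> Y n -` {- t<..t} \<inter> space M"
      proof
        fix \<omega>
        assume "\<omega> \<in> space M - ?A"
        then have "\<omega> \<in> space M" "\<bar>Y n \<omega>\<bar>\<^sup>2 < t\<^sup>2"
          by (auto simp: not_le)
        then show "\<omega> \<in> Y n -` {- t<..t} \<inter> space M"
          using t power_less_imp_less_base[of "\<bar>Y n \<omega>\<bar>" 2 t] by auto
      qed
    qed measurable
    also have "\<dots> = measure (distr M borel (Y n)) {- t<..t}"
      by (simp add: measure_distr)
    finally show ?thesis .
  qed
  then show "\<exists>a b. a < b \<and> (\<forall>n. 1 - \<epsilon> < measure (distr M borel (Y n)) {a<..b})"
    using t by (intro exI[of _ "- t"] exI[of _ t]) auto
qed

theorem theorem3p2: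
  fixes M :: "'a measure"
    and X :: "nat \<Rightarrow> 'a \<Rightarrow> real"
    and P0 :: "real measure"
    and F0 :: "real \<Rightarrow> real"
    and d \<mu>1 \<mu>2 l0 :: real
    and lhat :: "nat \<Rightarrow> 'a \<Rightarrow> real"
  assumes "prob_space M"
    and "0 < d" "d < 1/2"
    and "\<mu>1 \<noteq> \<mu>2"
    and "l0 \<in> {0..1/2 - d}"
    and "real_distribution P0"
    and "distr P0 borel uminus = P0"
    and "F0 = cdf P0"
    and "prob_space.indep_vars M (\<lambda>_. borel) X {1..}"
    and "\<And>i x. 1 \<le> i \<Longrightarrow>
           cdf (distr M borel (X i)) x = l0 * F0 (x - \<mu>1) + (1 - l0) * F0 (x - \<mu>2)"
    and "\<And>n. 1 \<le> n \<Longrightarrow> lhat n \<in> borel_measurable M"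
    and "\<And>n \<omega>. 1 \<le> n \<Longrightarrow> \<omega> \<in> space M \<Longrightarrow>
           is_arg_min (\<lambda>l. contrast \<mu>1 \<mu>2 l (emp_cdf X n \<omega>)) (\<lambda>l. l \<in> {0..1/2 - d}) (lhat n \<omega>)"
    and "strict_mono F0"
    and "\<exists>C. C-lipschitz_on UNIV F0"
  shows "(AE \<omega> in M. (\<lambda>n. lhat n \<omega>) \<longlonglongrightarrow> l0) \<and>
         tight (\<lambda>n. distr M borel (\<lambda>\<omega>. sqrt (real n) * (lhat n \<omega> - l0)))"
proof -
  interpret prob_space M by fact
  interpret P0: real_distribution P0 by fact
  obtain L' where L': "L'-lipschitz_on UNIV F0"
    using assms(14) by blast
  \<comment> \<open>Adding 1 makes the constant positive, as the division in \<open>r\<close>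
    requires.\<close>
  define L where "L = L' + 1"
  have L: "0 < L"
    using lipschitz_on_nonneg[OF L'] by (simp add: L_def)
  have lip: "\<bar>F0 x - F0 y\<bar> \<le> L * \<bar>x - y\<bar>" for x y
  proof -
    have "\<bar>F0 x - F0 y\<bar> \<le> L' * \<bar>x - y\<bar>"
      using lipschitz_onD[OF L', of x y] by (simp add: dist_real_def)
    then show ?thesis
      by (simp add: L_def distrib_right)
  qed
  \<comment> \<open>Continuity excludes an atom at \<open>x\<close>, so the reflected half-line
    \<open>{x..}\<close> has the same mass as \<open>{x<..}\<close>.\<close>
  have sym: "F0 (- x) = 1 - F0 x" for x
  proof -
    have "isCont F0 x"
      using lipschitz_on_continuous_on[OF L'] by (simp add: continuous_on_eq_continuous_at)
    then have x: "measure P0 {x} = 0"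
      unfolding \<open>F0 = cdf P0\<close> by (simp add: P0.isCont_cdf)
    have "F0 (- x) = measure (distr P0 borel uminus) {..- x}"
      by (simp add: \<open>F0 = cdf P0\<close> \<open>distr P0 borel uminus = P0\<close> cdf_def)
    also have "\<dots> = measure P0 {x..}"
      by (subst measure_distr) (auto intro!: arg_cong[where f = "measure P0"])
    also have "\<dots> = measure P0 {x} + measure P0 {x<..}"
      by (subst P0.finite_measure_Union[symmetric]) (auto intro!: arg_cong[where f = "measure P0"])
    also have "{x<..} = space P0 - {..x}"
      by auto
    also have "measure P0 (space P0 - {..x}) = 1 - F0 x"
      by (subst P0.prob_compl) (auto simp: \<open>F0 = cdf P0\<close> cdf_def)
    finally show ?thesis
      using x by simp
  qed
  interpret symmetric_mixture F0 \<mu>1 \<mu>2 l0 L d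
    by unfold_locales (use assms lip L sym P0.cdf_nonneg P0.cdf_bounded_prob in auto)
  interpret mixture_sample F0 \<mu>1 \<mu>2 l0 L d M X
    by unfold_locales (use assms in \<open>auto simp: G_eq fun_eq_iff\<close>)
  let ?B = "5 + 1 / (1 - q)"
  have bound: "(lhat n \<omega> - l0)\<^sup>2 \<le> C * W n \<omega>" if "1 \<le> n" "\<omega> \<in> space M" for n \<omega>
    using that by (intro estimator_bound assms)
  have "AE \<omega> in M. (\<lambda>n. lhat n \<omega>) \<longlonglongrightarrow> l0"
    using glivenko_cantelli AE_space
  proof eventually_elim
    case (elim \<omega>)
    show ?case
    proof (rule tendstoI)
      fix \<epsilon> :: real
      assume \<epsilon>: "0 < \<epsilon>"
      define c where "c = C * ?B"
      have c: "0 < c"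
        unfolding c_def using C_pos q by (intro mult_pos_pos add_pos_pos) auto
      \<comment> \<open>Chosen so that the bound \<open>C * (?B * t\<^sup>2)\<close> on the squared
        error equals \<open>(\<epsilon> / 2)\<^sup>2\<close>.\<close>
      define t where "t = \<epsilon> / (2 * sqrt c)"
      have t: "0 < t" "c * t\<^sup>2 = (\<epsilon> / 2)\<^sup>2"
        using c \<epsilon> by (auto simp: t_def power_divide power_mult_distrib)
      have "\<forall>\<^sub>F n in sequentially. \<forall>x. \<bar>emp_cdf X n \<omega> x - G x\<bar> \<le> t"
        using elim(1) t(1) by blast
      then show "\<forall>\<^sub>F n in sequentially. dist (lhat n \<omega>) l0 < \<epsilon>"
        using eventually_ge_at_top[of 1]
      proof eventually_elim
        case (elim n)
        have "(lhat n \<omega> - l0)\<^sup>2 \<le> C * W n \<omega>"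
          using elim(2) \<open>\<omega> \<in> space M\<close> by (rule bound)
        also have "\<dots> \<le> C * (?B * t\<^sup>2)"
          using elim C_pos by (intro mult_left_mono W_le) (auto simp: D_def)
        also have "\<dots> = (\<epsilon> / 2)\<^sup>2"
          using t(2) by (simp only: c_def mult.assoc)
        finally have "\<bar>lhat n \<omega> - l0\<bar> \<le> \<epsilon> / 2"
          using \<epsilon> power2_le_imp_le[of "\<bar>lhat n \<omega> - l0\<bar>" "\<epsilon> / 2"] by simp
        then show ?case
          using \<epsilon> by (simp add: dist_real_def)
      qed
    qed
  qed
  moreover have "tight (\<lambda>n. distr M borel (\<lambda>\<omega>. sqrt (real n) * (lhat n \<omega> - l0)))"
  proof (rule tight_if_bounded_second_moment[OF assms(1)])
    fix n
    \<comment> \<open>For \<open>n = 0\<close> the value of \<open>lhat 0\<close> is arbitrary, but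
      the factor \<open>sqrt 0\<close> makes the variable zero.\<close>
    show Y [measurable]: "(\<lambda>\<omega>. sqrt (real n) * (lhat n \<omega> - l0)) \<in> borel_measurable M"
      using assms(11)[of n] by (cases "n = 0") auto
    have sq: "(sqrt (real n) * (lhat n \<omega> - l0))\<^sup>2 = real n * (lhat n \<omega> - l0)\<^sup>2" for \<omega>
      by (simp add: power_mult_distrib)
    have le: "(sqrt (real n) * (lhat n \<omega> - l0))\<^sup>2 \<le> real n * (C * W n \<omega>)" if "\<omega> \<in> space M" for \<omega>
      using bound[of n \<omega>] that unfolding sq by (cases "n = 0") (auto intro!: mult_left_mono)
    have W_int: "integrable M (\<lambda>\<omega>. real n * (C * W n \<omega>))"
      using W_expectation(1)[of n] by (cases "n = 0") auto
    show int: "integrable M (\<lambda>\<omega>. (sqrt (real n) * (lhat n \<omega> - l0))\<^sup>2)"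
      by (rule Bochner_Integration.integrable_bound[OF W_int])
        (auto intro!: AE_I2 order_trans[OF le abs_ge_self])
    have "(LINT \<omega>|M. (sqrt (real n) * (lhat n \<omega> - l0))\<^sup>2) \<le> (LINT \<omega>|M. real n * (C * W n \<omega>))"
      by (intro integral_mono int W_int le)
    also have "\<dots> = real n * (C * expectation (W n))"
      by simp
    \<comment> \<open>The factor \<open>n\<close> cancels the \<open>1 / n\<close> in the bound on
      the expectation of \<open>W n\<close>.\<close>
    also have "\<dots> \<le> C * ?B * 3"
    proof (cases "n = 0")
      case True
      then show ?thesis
        using C_pos q by simp
    next
      case False
      then have "real n * (C * expectation (W n)) \<le> real n * (C * (?B * (3 / real n)))"
        using C_pos by (intro mult_left_mono W_expectation) auto
      moreover have "real n * (C * (b * (3 / real n))) = C * b * 3" for b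
        using False by simp
      ultimately show ?thesis
        by metis
    qed
    finally show "(LINT \<omega>|M. (sqrt (real n) * (lhat n \<omega> - l0))\<^sup>2) \<le> C * ?B * 3" .
  qed
  ultimately show ?thesis ..
qed

end
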